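(* Let $m,n\ge 1$, let $A\in\mathbb{R}^{m\times m}$, $B\in\mathbb{R}^{m\times n}$, $C\in\mathbb{R}^{n\times m}$, $D\in\mathbb{R}^{n\times n}$, and assume that $$K=\begin{bmatrix} D & -C\\ -B & A\end{bmatrix}$$ is a regular $M$-matrix. Let $$H=\begin{bmatrix} D & -C\\ B & -A\end{bmatrix}.$$ Let all the eigenvalues of $H$ (counted with algebraic multiplicity) be arranged in descending order by their real parts and denoted by $\lambda_1,\ldots,\lambda_n,\lambda_{n+1},\ldots,\lambda_{n+m}$. Let $\Phi$ be the minimal nonnegative solution of $XCX-XD-AX+B=0$ and let $\Psi$ be the minimal nonnegative solution of the dual equation $YBY-YA-DY+C=0$. Then the eigenvalues of $D-C\Phi$ are $\lambda_1,\ldots,\lambda_n$ and the eigenvalues of $A-B\Psi$ are $-\lambda_{n+1},\ldots,-\lambda_{n+m}$ (with algebraic multiplicity). In particular, $\lambda_n$ and $\lambda_{n+1}$ are real numbers.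
   Context: For real matrices or vectors of the same size, $A\ge B$ ($A>B$) means $a_{ij}\ge b_{ij}$ ($a_{ij}>b_{ij}$) for all $i,j$; a matrix $X$ is nonnegative if $X\ge 0$. A real square matrix is a $Z$-matrix if all its off-diagonal entries are nonpositive; any $Z$-matrix can be written as $sI-N$ with $N\ge 0$. A $Z$-matrix $sI-N$ ($N\ge 0$) is an $M$-matrix if $s\ge\rho(N)$, where $\rho$ is the spectral radius. An $M$-matrix $A$ is regular if $Av\ge 0$ for some vector $v>0$. A minimal nonnegative solution of a matrix equation is a nonnegative solution that is entrywise $\le$ every nonnegative solution. The unknowns are $X\in\mathbb{R}^{m\times n}$ and $Y\in\mathbb{R}^{n\times m}$; when $K$ is a regular $M$-matrix, both minimal nonnegative solutions $\Phi$ and $\Psi$ exist. *)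

theory Defs
  imports "Jordan_Normal_Form.Spectral_Radius"
begin

text \<open>On matrices and vectors \<open>\<le>\<close> is the library's entrywise order (which includes equality of
  dimensions), but the library's \<open><\<close> is merely the strict part of that order. The entrywise
  strict inequality \<open>v > 0\<close> is therefore written out componentwise.\<close>

definition nonneg_mat :: "real mat \<Rightarrow> bool" where
  "nonneg_mat X \<longleftrightarrow> 0\<^sub>m (dim_row X) (dim_col X) \<le> X"

definition Z_matrix :: "real mat \<Rightarrow> bool" where
  "Z_matrix A \<longleftrightarrow> square_mat A \<and>
     (\<forall>i<dim_row A. \<forall>j<dim_row A. i \<noteq> j \<longrightarrow> A $$ (i, j) \<le> 0)"

definition M_matrix :: "real mat \<Rightarrow> bool" where
  "M_matrix A \<longleftrightarrow> Z_matrix A \<and>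
     (\<exists>s N. N \<in> carrier_mat (dim_row A) (dim_row A) \<and> nonneg_mat N \<and>
            A = s \<cdot>\<^sub>m 1\<^sub>m (dim_row A) - N \<and>
            s \<ge> spectral_radius (map_mat complex_of_real N))"

definition regular_M_matrix :: "real mat \<Rightarrow> bool" where
  "regular_M_matrix A \<longleftrightarrow> M_matrix A \<and>
     (\<exists>v \<in> carrier_vec (dim_row A).
        (\<forall>i<dim_row A. v $ i > 0) \<and> A *\<^sub>v v \<ge> 0\<^sub>v (dim_row A))"

definition minimal_nonneg_solution ::
    "nat \<Rightarrow> nat \<Rightarrow> (real mat \<Rightarrow> bool) \<Rightarrow> real mat \<Rightarrow> bool" where
  "minimal_nonneg_solution r c P X \<longleftrightarrow>
     X \<in> carrier_mat r c \<and> nonneg_mat X \<and> P X \<and>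
     (\<forall>Y \<in> carrier_mat r c. nonneg_mat Y \<and> P Y \<longrightarrow> X \<le> Y)"

text \<open>The complex eigenvalues of a real square matrix, each repeated according to its algebraic
  multiplicity.\<close>

definition eigenvalue_mset :: "real mat \<Rightarrow> complex multiset" where
  "eigenvalue_mset A = proots (char_poly (map_mat complex_of_real A))"

end

theory Submission
  imports Defs
begin

text \<open>A solution \<open>X\<close> of \<open>X C X - X D - A X + B = 0\<close> makes the Hamiltonian \<open>H\<close> similar to the block
  triangular matrix with diagonal blocks \<open>D - C X\<close> and \<open>- (A - X C)\<close>, so the spectrum of \<open>H\<close> is the
  union of the spectra of \<open>D - C \<Phi>\<close> and \<open>- (A - \<Phi> C)\<close> (\<open>hamiltonian_eigenvalues\<close>). The point is
  that the eigenvalues of both \<open>D - C \<Phi>\<close> and \<open>A - \<Phi> C\<close> have positive real part or are zero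
  (\<open>closed_loop_spectra\<close>). The first block then contributes exactly the \<open>n\<close> eigenvalues of largest
  real part: the only number that both parts of the spectrum can share is \<open>0\<close>, and ties on the
  imaginary axis are therefore harmless (\<open>multiset_split_by_real_part\<close>). The statement about \<open>\<Psi>\<close>
  follows by exchanging the roles of \<open>(A, B)\<close> and \<open>(D, C)\<close>, which turns \<open>H\<close> into a matrix similar
  to \<open>- H\<close>.

  Write \<open>A = s I - P\<close> and \<open>D = s I - Q\<close> with \<open>P\<close>, \<open>Q\<close> nonnegative. The Riccati equation becomes a
  monotone fixed point equation, whose iterates from \<open>0\<close> increase to \<open>\<Phi>\<close>. Regularity gives
  positive \<open>v\<^sub>1\<close>, \<open>v\<^sub>2\<close> with \<open>Q v\<^sub>1 + C v\<^sub>2 \<le> s v\<^sub>1\<close> and \<open>B v\<^sub>1 + P v\<^sub>2 \<le> s v\<^sub>2\<close>. Along the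
  iteration \<open>X v\<^sub>1 \<le> v\<^sub>2\<close> is preserved, hence \<open>(Q + C \<Phi>) v\<^sub>1 \<le> s v\<^sub>1\<close>, and all eigenvalues of
  \<open>Q + C \<Phi>\<close> lie in the disc of radius \<open>s\<close>. For \<open>P + \<Phi> C\<close> the same argument, transposed, needs a
  positive left vector. When \<open>K\<close> is singular and reducible there may be none, but there is one for
  every \<open>t > s\<close> (\<open>subinvariant_transpose\<close>). It bounds the eigenvalues for the iteration with
  parameter \<open>t\<close>, and the bound survives the limits \<open>t \<rightarrow> s\<close> and then iterates \<open>\<rightarrow> \<Phi>\<close>
  (\<open>eigen_bound_lim\<close>).

  Finally, \<open>\<lambda>\<^sub>n\<close> is an eigenvalue of smallest real part of \<open>D - C \<Phi>\<close>, and \<open>- \<lambda>\<^sub>n\<^sub>+\<^sub>1\<close> one of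
  \<open>A - B \<Psi>\<close>. The first is real because the nonnegative matrix \<open>Q + C \<Phi>\<close> has its spectral radius
  among its eigenvalues (\<open>dominant_eigenvalue_exists\<close>), and the second for the dual reason.\<close>

section \<open>Entrywise order on matrices and vectors\<close>

lemma mult_mat_vec_index:
  assumes "A \<in> carrier_mat nr nc" and "v \<in> carrier_vec nc" and "i < nr"
  shows "(A *\<^sub>v v) $ i = (\<Sum>j<nc. A $$ (i, j) * v $ j)"
  using assms by (auto simp: scalar_prod_def lessThan_atLeast0 intro!: sum.cong)

lemma mult_mat_index:
  assumes "A \<in> carrier_mat nr n" and "B \<in> carrier_mat n nc" and "i < nr" and "j < nc"
  shows "(A * B) $$ (i, j) = (\<Sum>k<n. A $$ (i, k) * B $$ (k, j))"
  using assms by (auto simp: scalar_prod_def lessThan_atLeast0 intro!: sum.cong)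

lemma mult_mat_vec_mono:
  fixes A :: "real mat"
  assumes "A \<in> carrier_mat nr nc" and "0\<^sub>m nr nc \<le> A" and "x \<in> carrier_vec nc" and "x \<le> y"
  shows "A *\<^sub>v x \<le> A *\<^sub>v y"
proof -
  have y: "y \<in> carrier_vec nc" and le: "\<And>j. j < nc \<Longrightarrow> x $ j \<le> y $ j"
    using assms(3,4) by (auto simp: less_eq_vec_def)
  have "(A *\<^sub>v x) $ i \<le> (A *\<^sub>v y) $ i" if i: "i < nr" for i
    unfolding mult_mat_vec_index[OF assms(1,3) i] mult_mat_vec_index[OF assms(1) y i]
    using assms(1,2) i le by (intro sum_mono mult_left_mono) (auto simp: less_eq_mat_def)
  thus ?thesis using assms(1) by (auto simp: less_eq_vec_def)
qed

lemma mult_mat_vec_nonneg: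
  fixes A :: "real mat"
  assumes "A \<in> carrier_mat nr nc" and "0\<^sub>m nr nc \<le> A" and "x \<in> carrier_vec nc" and "0\<^sub>v nc \<le> x"
  shows "0\<^sub>v nr \<le> A *\<^sub>v x"
proof -
  have "A *\<^sub>v 0\<^sub>v nc = 0\<^sub>v nr" using assms(1) by (intro eq_vecI) auto
  thus ?thesis using mult_mat_vec_mono[OF assms(1,2) zero_carrier_vec assms(4)] by simp
qed

lemma mult_mat_mono:
  fixes A B :: "real mat"
  assumes A: "A \<in> carrier_mat nr n" and X: "X \<in> carrier_mat n nc"
    and "0\<^sub>m nr n \<le> A" and "A \<le> B" and "0\<^sub>m n nc \<le> X" and "X \<le> Y"
  shows "A * X \<le> B * Y"
proof -
  have B: "B \<in> carrier_mat nr n" and Y: "Y \<in> carrier_mat n nc"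
    using assms by (auto simp: less_eq_mat_def)
  have "(A * X) $$ (i, j) \<le> (B * Y) $$ (i, j)" if i: "i < nr" and j: "j < nc" for i j
    unfolding mult_mat_index[OF A X i j] mult_mat_index[OF B Y i j]
    using assms i j
    by (intro sum_mono mult_mono) (force simp: less_eq_mat_def)+
  thus ?thesis using A B X Y by (auto simp: less_eq_mat_def)
qed

lemma mult_mat_nonneg:
  fixes A B :: "real mat"
  assumes "A \<in> carrier_mat nr n" and "B \<in> carrier_mat n nc"
    and "0\<^sub>m nr n \<le> A" and "0\<^sub>m n nc \<le> B"
  shows "0\<^sub>m nr nc \<le> A * B"
  using mult_mat_mono[of "0\<^sub>m nr n" nr n "0\<^sub>m n nc" nc A B] assms by auto

lemma add_mat_nonneg:
  fixes A B :: "real mat"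
  assumes "A \<in> carrier_mat nr nc" and "B \<in> carrier_mat nr nc"
    and "0\<^sub>m nr nc \<le> A" and "0\<^sub>m nr nc \<le> B"
  shows "0\<^sub>m nr nc \<le> A + B"
  using assms by (auto simp: less_eq_mat_def)

lemma smult_mat_mult_vec:
  fixes A :: "'a :: comm_ring_1 mat"
  assumes "A \<in> carrier_mat nr nc" and "x \<in> carrier_vec nc"
  shows "(a \<cdot>\<^sub>m A) *\<^sub>v x = a \<cdot>\<^sub>v (A *\<^sub>v x)"
  using assms by (intro eq_vecI) auto

lemma shifted_mult_vec:
  fixes N :: "'a :: comm_ring_1 mat"
  assumes "N \<in> carrier_mat n n" and "x \<in> carrier_vec n"
  shows "(t \<cdot>\<^sub>m 1\<^sub>m n - N) *\<^sub>v x = t \<cdot>\<^sub>v x - N *\<^sub>v x"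
  using assms by (simp add: minus_mult_distrib_mat_vec[of _ n n] smult_mat_mult_vec[of _ n n])

lemma transpose_mat_nonneg:
  fixes A :: "real mat"
  assumes "A \<in> carrier_mat nr nc" and "0\<^sub>m nr nc \<le> A"
  shows "0\<^sub>m nc nr \<le> A\<^sup>T"
  using assms by (auto simp: less_eq_mat_def)

section \<open>Nonnegative matrices with a positive subinvariant vector\<close>

text \<open>\<open>v\<close> is an entrywise positive vector with \<open>N v \<le> s v\<close>. For nonnegative \<open>N\<close> such a vector
  certifies that the spectral radius of \<open>N\<close> is at most \<open>s\<close>.\<close>

definition subinvariant :: "nat \<Rightarrow> real mat \<Rightarrow> real \<Rightarrow> real vec \<Rightarrow> bool" where
  "subinvariant n N s v \<longleftrightarrow>
     v \<in> carrier_vec n \<and> (\<forall>i<n. v $ i > 0) \<and> N *\<^sub>v v \<le> s \<cdot>\<^sub>v v"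

lemma subinvariantD:
  assumes "subinvariant n N s v" and "N \<in> carrier_mat n n"
  shows "v \<in> carrier_vec n" and "\<And>i. i < n \<Longrightarrow> v $ i > 0"
    and "\<And>i. i < n \<Longrightarrow> (\<Sum>j<n. N $$ (i, j) * v $ j) \<le> s * v $ i"
proof -
  show v: "v \<in> carrier_vec n" and "\<And>i. i < n \<Longrightarrow> v $ i > 0"
    using assms(1) by (auto simp: subinvariant_def)
  fix i assume i: "i < n"
  have "(N *\<^sub>v v) $ i \<le> (s \<cdot>\<^sub>v v) $ i"
    using assms(1) i v unfolding subinvariant_def less_eq_vec_def by auto
  thus "(\<Sum>j<n. N $$ (i, j) * v $ j) \<le> s * v $ i"
    using mult_mat_vec_index[OF assms(2) v i] i v by simp
qed

lemma subinvariant_nonneg: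
  assumes "subinvariant n N s v" and "N \<in> carrier_mat n n" and "0\<^sub>m n n \<le> N" and "n > 0"
  shows "s \<ge> 0"
proof -
  note v = subinvariantD[OF assms(1,2)]
  have "0 \<le> (\<Sum>j<n. N $$ (0, j) * v $ j)"
    using assms v(2) by (intro sum_nonneg mult_nonneg_nonneg) (auto simp: less_eq_mat_def less_imp_le)
  also have "\<dots> \<le> s * v $ 0" using v(3) assms(4) by simp
  finally show ?thesis using v(2)[OF assms(4)] by (simp add: zero_le_mult_iff)
qed

text \<open>Above \<open>s\<close>, the matrix \<open>t I - N\<close> is inverse-positive.\<close>

lemma subinvariant_inverse_positive:
  assumes sub: "subinvariant n N s v" and N: "N \<in> carrier_mat n n" and N0: "0\<^sub>m n n \<le> N"
    and st: "s < t" and w: "w \<in> carrier_vec n" and Nw: "N *\<^sub>v w \<le> t \<cdot>\<^sub>v w"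
  shows "0\<^sub>v n \<le> w"
proof (cases "n = 0")
  case True
  thus ?thesis using w by (auto simp: less_eq_vec_def)
next
  case False
  note v = subinvariantD[OF sub N]
  \<comment> \<open>If the smallest ratio of the entries of \<open>w\<close> and \<open>v\<close> were negative, the row of \<open>N\<close> in which it
    is attained would violate \<open>N w \<le> t w\<close>.\<close>
  define f where "f = (\<lambda>i. w $ i / v $ i)"
  define i where "i = arg_min_on f {..<n}"
  have i: "i < n" using arg_min_if_finite(1)[of "{..<n}" f] False by (auto simp: i_def)
  have least: "f i \<le> f j" if "j < n" for j
    using arg_min_least[of "{..<n}" j f] that by (auto simp: i_def)
  have wv: "w $ j = f j * v $ j" if "j < n" for j using v(2)[OF that] by (simp add: f_def)
  have "f i \<ge> 0"
  proof (rule ccontr)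
    assume neg: "\<not> f i \<ge> 0"
    have "f i * (s * v $ i) \<le> f i * (\<Sum>j<n. N $$ (i, j) * v $ j)"
      using v(3)[OF i] neg by (intro mult_left_mono_neg) auto
    also have "\<dots> = (\<Sum>j<n. N $$ (i, j) * (f i * v $ j))"
      by (simp add: sum_distrib_left algebra_simps)
    also have "\<dots> \<le> (\<Sum>j<n. N $$ (i, j) * w $ j)"
      using N N0 i wv least v(2)
      by (intro sum_mono mult_left_mono) (auto simp: less_eq_mat_def intro!: mult_right_mono less_imp_le)
    also have "\<dots> = (N *\<^sub>v w) $ i" using mult_mat_vec_index[OF N w i] by simp
    also have "\<dots> \<le> t * w $ i" using Nw i w by (auto simp: less_eq_vec_def)
    also have "\<dots> = f i * (t * v $ i)" using wv[OF i] by simp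
    finally have "t * v $ i \<le> s * v $ i" using neg by simp
    thus False using v(2)[OF i] st by simp
  qed
  hence "w $ j \<ge> 0" if "j < n" for j
    using wv[OF that] least[OF that] v(2)[OF that] by (simp add: less_imp_le)
  thus ?thesis using w by (auto simp: less_eq_vec_def)
qed

lemma subinvariant_det:
  assumes sub: "subinvariant n N s v" and N: "N \<in> carrier_mat n n" and N0: "0\<^sub>m n n \<le> N"
    and st: "s < t"
  shows "det (t \<cdot>\<^sub>m 1\<^sub>m n - N) \<noteq> 0"
proof
  assume "det (t \<cdot>\<^sub>m 1\<^sub>m n - N) = 0"
  then obtain w where w: "w \<in> carrier_vec n" "w \<noteq> 0\<^sub>v n"
    and *: "(t \<cdot>\<^sub>m 1\<^sub>m n - N) *\<^sub>v w = 0\<^sub>v n"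
    using det_0_iff_vec_prod_zero_field[of "t \<cdot>\<^sub>m 1\<^sub>m n - N" n] minus_carrier_mat[OF N] by auto
  have "t \<cdot>\<^sub>v w - N *\<^sub>v w = 0\<^sub>v n"
    using * N w(1) by (simp add: shifted_mult_vec)
  hence "(t \<cdot>\<^sub>v w - N *\<^sub>v w) $ i = 0" if "i < n" for i using that by simp
  hence eq: "(N *\<^sub>v w) $ i = t * w $ i" if "i < n" for i using that w(1) N by force
  have "0\<^sub>v n \<le> w"
    by (rule subinvariant_inverse_positive[OF sub N N0 st w(1)]) (use eq N w(1) in \<open>auto simp: less_eq_vec_def\<close>)
  moreover have "0\<^sub>v n \<le> - w"
    by (rule subinvariant_inverse_positive[OF sub N N0 st])
      (use eq N w(1) in \<open>auto simp: less_eq_vec_def\<close>)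
  ultimately have "w = 0\<^sub>v n" using w(1) by (intro eq_vecI) (force simp: less_eq_vec_def)+
  thus False using w(2) by simp
qed

text \<open>Strictly above \<open>s\<close>, subinvariant vectors exist on the left as well: the vector of column sums
  of the inverse of \<open>t I - N\<close> is one. At \<open>s\<close> itself there need not be any.\<close>

lemma subinvariant_transpose:
  assumes sub: "subinvariant n N s v" and N: "N \<in> carrier_mat n n" and N0: "0\<^sub>m n n \<le> N"
    and st: "s < t"
  obtains u where "subinvariant n N\<^sup>T t u"
proof (cases "n = 0")
  case True
  have "subinvariant n N\<^sup>T t (0\<^sub>v n)" using True N by (auto simp: subinvariant_def less_eq_vec_def)
  thus ?thesis by (rule that)
next
  case False
  define M where "M = t \<cdot>\<^sub>m 1\<^sub>m n - N"
  have M: "M \<in> carrier_mat n n" using N by (auto simp: M_def)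
  obtain W where W: "W \<in> carrier_mat n n" and MW: "M * W = 1\<^sub>m n" and WM: "W * M = 1\<^sub>m n"
    using det_non_zero_imp_unit[OF M, of "()"] subinvariant_det[OF sub N N0 st]
    unfolding Units_def ring_mat_def M_def by auto
  have Mvec: "M *\<^sub>v x = t \<cdot>\<^sub>v x - N *\<^sub>v x" if "x \<in> carrier_vec n" for x
    using that N by (simp add: M_def shifted_mult_vec)
  have Wcol: "0\<^sub>v n \<le> col W j" if j: "j < n" for j
  proof (rule subinvariant_inverse_positive[OF sub N N0 st])
    show c: "col W j \<in> carrier_vec n" using W by (intro carrier_vecI) simp
    have "t \<cdot>\<^sub>v col W j - N *\<^sub>v col W j = unit_vec n j"
      using Mvec[OF c] col_mult2[OF M W j] MW j by simp
    hence "(t \<cdot>\<^sub>v col W j - N *\<^sub>v col W j) $ i \<ge> 0" if "i < n" for i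
      using that j by simp
    thus "N *\<^sub>v col W j \<le> t \<cdot>\<^sub>v col W j" using N W by (force simp: less_eq_vec_def)
  qed
  define e :: "real vec" where "e = vec n (\<lambda>_. 1)"
  define u where "u = W\<^sup>T *\<^sub>v e"
  have e: "e \<in> carrier_vec n" and u: "u \<in> carrier_vec n" using W by (auto simp: e_def u_def)
  have "M\<^sup>T *\<^sub>v u = (M\<^sup>T * W\<^sup>T) *\<^sub>v e" unfolding u_def by (subst assoc_mult_mat_vec) (use M W e in auto)
  also have "M\<^sup>T * W\<^sup>T = 1\<^sub>m n" using WM transpose_mult[OF W M] by simp
  finally have "M\<^sup>T *\<^sub>v u = e" using e by simp
  moreover have "M\<^sup>T = t \<cdot>\<^sub>m 1\<^sub>m n - N\<^sup>T" using N by (auto simp: M_def)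
  ultimately have "t \<cdot>\<^sub>v u - N\<^sup>T *\<^sub>v u = e"
    using u N by (simp add: shifted_mult_vec)
  hence "(t \<cdot>\<^sub>v u - N\<^sup>T *\<^sub>v u) $ i = 1" if "i < n" for i using that by (simp add: e_def)
  hence eq: "t * u $ i = 1 + (N\<^sup>T *\<^sub>v u) $ i" if "i < n" for i using that u N by force
  have u0: "0\<^sub>v n \<le> u"
  proof -
    have "u $ i \<ge> 0" if i: "i < n" for i
    proof -
      have "u $ i = (\<Sum>j<n. W\<^sup>T $$ (i, j) * e $ j)"
        unfolding u_def by (rule mult_mat_vec_index) (use W e i in auto)
      also have "\<dots> \<ge> 0" using W i Wcol[OF i]
        by (intro sum_nonneg) (auto simp: e_def less_eq_vec_def)
      finally show ?thesis .
    qed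
    thus ?thesis using u by (auto simp: less_eq_vec_def)
  qed
  have "0\<^sub>m n n \<le> N\<^sup>T" using transpose_mat_nonneg[OF N N0] .
  from mult_mat_vec_nonneg[OF _ this u u0] have Nu: "0\<^sub>v n \<le> N\<^sup>T *\<^sub>v u" using N by auto
  have t0: "t > 0" using subinvariant_nonneg[OF sub N N0] False st by simp
  have "subinvariant n N\<^sup>T t u"
    unfolding subinvariant_def
  proof (intro conjI allI impI u)
    fix i assume i: "i < n"
    have "t * u $ i > 0" using eq[OF i] Nu i by (auto simp: less_eq_vec_def)
    thus "u $ i > 0" using t0 by (simp add: zero_less_mult_iff)
  next
    show "N\<^sup>T *\<^sub>v u \<le> t \<cdot>\<^sub>v u" using eq N u by (auto simp: less_eq_vec_def)
  qed
  thus ?thesis by (rule that)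
qed

section \<open>Eigenvalues of nonnegative matrices\<close>

text \<open>All complex eigenvalues of the real matrix lie in the closed disc of radius \<open>r\<close> around zero.\<close>

definition eigen_bound :: "real mat \<Rightarrow> real \<Rightarrow> bool" where
  "eigen_bound N r \<longleftrightarrow> (\<forall>z. eigenvalue (map_mat complex_of_real N) z \<longrightarrow> cmod z \<le> r)"

text \<open>At the row where \<open>\<bar>x\<^sub>i\<bar> / v\<^sub>i\<close> is largest, an eigenvector \<open>x\<close> cannot grow by more than \<open>s\<close>.\<close>

lemma subinvariant_eigen_bound:
  assumes sub: "subinvariant n N s v" and N: "N \<in> carrier_mat n n" and N0: "0\<^sub>m n n \<le> N"
  shows "eigen_bound N s"
  unfolding eigen_bound_def
proof (intro allI impI)
  fix z assume ev: "eigenvalue (map_mat complex_of_real N) z"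
  let ?N = "map_mat complex_of_real N"
  have Nc: "?N \<in> carrier_mat n n" using N by auto
  obtain x where x: "x \<in> carrier_vec n" "x \<noteq> 0\<^sub>v n" "?N *\<^sub>v x = z \<cdot>\<^sub>v x"
    using ev N unfolding eigenvalue_def eigenvector_def by auto
  obtain k where k: "k < n" "x $ k \<noteq> 0"
    using x(1,2) by (metis eq_vecI index_zero_vec carrier_vecD)
  note v = subinvariantD[OF sub N]
  define f where "f = (\<lambda>i. - (cmod (x $ i) / v $ i))"
  define i where "i = arg_min_on f {..<n}"
  have i: "i < n" using arg_min_if_finite(1)[of "{..<n}" f] k by (auto simp: i_def)
  have least: "f i \<le> f j" if "j < n" for j
    using arg_min_least[of "{..<n}" j f] that by (auto simp: i_def)
  define c where "c = - f i"
  have xi: "cmod (x $ i) = c * v $ i" using v(2)[OF i] by (simp add: c_def f_def)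
  have xj: "cmod (x $ j) \<le> c * v $ j" if "j < n" for j
    using least[OF that] v(2)[OF that] by (simp add: c_def f_def field_simps)
  have "0 < c * v $ k" using xj[OF k(1)] k(2) by (meson less_le_trans zero_less_norm_iff)
  hence c: "c > 0" using v(2)[OF k(1)] by (simp add: zero_less_mult_iff)
  have "cmod z * cmod (x $ i) = cmod ((?N *\<^sub>v x) $ i)" using x i by (simp add: norm_mult)
  also have "\<dots> = cmod (\<Sum>j<n. ?N $$ (i, j) * x $ j)"
    using mult_mat_vec_index[OF Nc x(1) i] by simp
  also have "\<dots> \<le> (\<Sum>j<n. N $$ (i, j) * cmod (x $ j))"
    using N N0 i by (intro order_trans[OF norm_sum]) (auto simp: norm_mult less_eq_mat_def intro!: sum_mono)
  also have "\<dots> \<le> (\<Sum>j<n. N $$ (i, j) * (c * v $ j))"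
    using N N0 i xj by (intro sum_mono mult_left_mono) (auto simp: less_eq_mat_def)
  also have "\<dots> = c * (\<Sum>j<n. N $$ (i, j) * v $ j)" by (simp add: sum_distrib_left algebra_simps)
  also have "\<dots> \<le> c * (s * v $ i)" using v(3)[OF i] c by simp
  finally have "cmod z * (c * v $ i) \<le> s * (c * v $ i)" using xi by (simp add: algebra_simps)
  thus "cmod z \<le> s" using c v(2)[OF i] by simp
qed

lemma eigen_bound_transpose:
  assumes "N \<in> carrier_mat n n" and "eigen_bound N\<^sup>T r"
  shows "eigen_bound N r"
proof -
  have c: "map_mat complex_of_real N \<in> carrier_mat n n"
    "map_mat complex_of_real N\<^sup>T \<in> carrier_mat n n"
    using assms by auto
  show ?thesis
    using assms(2) char_poly_transpose_mat[OF c(1)]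
    unfolding eigen_bound_def eigenvalue_root_char_poly[OF c(1)] eigenvalue_root_char_poly[OF c(2)]
    by (simp add: map_mat_transpose)
qed

text \<open>A weak form of the Perron-Frobenius theorem. The dominant eigenvalue is the infimum \<open>r\<close> of all
  \<open>t\<close> that admit a positive \<open>v\<close> with \<open>N v \<le> t v\<close>: if \<open>r I - N\<close> were invertible, the solution \<open>w\<close>
  of \<open>(r I - N) w = (1, \<dots>, 1)\<close> would be positive, and would be subinvariant for a smaller number.\<close>

lemma dominant_eigenvalue_exists:
  assumes sub: "subinvariant n N s v" and N: "N \<in> carrier_mat n n" and N0: "0\<^sub>m n n \<le> N"
    and n: "n > 0"
  obtains r where "eigenvalue (map_mat complex_of_real N) (complex_of_real r)" and "eigen_bound N r"
proof -
  define T where "T = {t. \<exists>v. subinvariant n N t v}"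
  define r where "r = Inf T"
  have T: "s \<in> T" "\<And>t. t \<in> T \<Longrightarrow> t \<ge> 0"
    using sub subinvariant_nonneg[OF _ N N0 n] by (auto simp: T_def)
  have bdd: "bdd_below T" using T(2) by (meson bdd_belowI)
  have ge: "r \<ge> c" if "\<And>t. t \<in> T \<Longrightarrow> t \<ge> c" for c
    unfolding r_def using T(1) that by (intro cInf_greatest) auto
  have bound: "eigen_bound N r"
    unfolding eigen_bound_def
    using ge subinvariant_eigen_bound[OF _ N N0] by (auto simp: eigen_bound_def T_def)
  have "det (r \<cdot>\<^sub>m 1\<^sub>m n - N) = 0"
  proof (rule ccontr)
    assume det: "det (r \<cdot>\<^sub>m 1\<^sub>m n - N) \<noteq> 0"
    define M where "M = r \<cdot>\<^sub>m 1\<^sub>m n - N"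
    have M: "M \<in> carrier_mat n n" using N by (auto simp: M_def)
    obtain W where W: "W \<in> carrier_mat n n" and MW: "M * W = 1\<^sub>m n"
      using det_non_zero_imp_unit[OF M, of "()"] det unfolding Units_def ring_mat_def M_def by auto
    define e :: "real vec" where "e = vec n (\<lambda>_. 1)"
    define w where "w = W *\<^sub>v e"
    have e: "e \<in> carrier_vec n" and w: "w \<in> carrier_vec n" using W by (auto simp: e_def w_def)
    have "M *\<^sub>v w = (M * W) *\<^sub>v e" unfolding w_def by (subst assoc_mult_mat_vec) (use M W e in auto)
    hence "M *\<^sub>v w = e" using MW e by simp
    hence "r \<cdot>\<^sub>v w - N *\<^sub>v w = e"
      using w N by (simp add: M_def shifted_mult_vec)
    hence "(r \<cdot>\<^sub>v w - N *\<^sub>v w) $ i = 1" if "i < n" for i using that by (simp add: e_def)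
    hence eq: "(N *\<^sub>v w) $ i = r * w $ i - 1" if "i < n" for i using that w N by force
    define b where "b = 1 + (\<Sum>i<n. \<bar>w $ i\<bar>)"
    have b1: "b \<ge> 1" by (simp add: b_def sum_nonneg)
    have b: "\<bar>w $ i\<bar> \<le> b" if "i < n" for i
      using member_le_sum[of i "{..<n}" "\<lambda>i. \<bar>w $ i\<bar>"] that by (simp add: b_def)
    \<comment> \<open>As \<open>b\<close> bounds the moduli of all entries of \<open>w\<close>, shifting \<open>r\<close> by \<open>1 / b\<close> changes \<open>r w\<close> by at
      most one.\<close>
    obtain t where t: "t \<in> T" "t < r + 1 / b"
      using cInf_lessD[of T "r + 1 / b"] T(1) b1 by (auto simp: r_def)
    then obtain v' where v': "subinvariant n N t v'" by (auto simp: T_def)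
    have w0: "0\<^sub>v n \<le> w"
    proof (rule subinvariant_inverse_positive[OF v' N N0 t(2) w])
      have "r * w $ i - 1 \<le> (r + 1 / b) * w $ i" if "i < n" for i
        using b[OF that] b1 by (simp add: field_simps abs_le_iff)
      thus "N *\<^sub>v w \<le> (r + 1 / b) \<cdot>\<^sub>v w" using eq N w by (auto simp: less_eq_vec_def)
    qed
    have Nw: "0\<^sub>v n \<le> N *\<^sub>v w" by (rule mult_mat_vec_nonneg[OF N N0 w w0])
    have rw: "r * w $ i \<ge> 1" if "i < n" for i using eq[OF that] Nw that by (auto simp: less_eq_vec_def)
    have wpos: "w $ i > 0" if "i < n" for i
    proof -
      have "w $ i \<noteq> 0" using rw[OF that] by auto
      thus ?thesis using w0 that by (force simp: less_eq_vec_def)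
    qed
    have "r * w $ i - 1 \<le> (r - 1 / b) * w $ i" if "i < n" for i
      using b[OF that] b1 by (simp add: field_simps abs_le_iff)
    hence "subinvariant n N (r - 1 / b) w"
      using eq N w wpos by (auto simp: subinvariant_def less_eq_vec_def)
    hence "r - 1 / b \<in> T" by (auto simp: T_def)
    hence "r \<le> r - 1 / b" unfolding r_def using bdd by (intro cInf_lower)
    thus False using b1 by simp
  qed
  then obtain x where x: "x \<in> carrier_vec n" "x \<noteq> 0\<^sub>v n" "(r \<cdot>\<^sub>m 1\<^sub>m n - N) *\<^sub>v x = 0\<^sub>v n"
    using det_0_iff_vec_prod_zero_field[of "r \<cdot>\<^sub>m 1\<^sub>m n - N" n] minus_carrier_mat[OF N] by auto
  have "r \<cdot>\<^sub>v x - N *\<^sub>v x = 0\<^sub>v n"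
    using x N by (simp add: shifted_mult_vec)
  hence "(r \<cdot>\<^sub>v x - N *\<^sub>v x) $ i = 0" if "i < n" for i using that by simp
  hence "(N *\<^sub>v x) $ i = r * x $ i" if "i < n" for i using that x(1) N by force
  hence "N *\<^sub>v x = r \<cdot>\<^sub>v x" using N x(1) by (intro eq_vecI) auto
  hence "eigenvalue N r" using x N unfolding eigenvalue_def eigenvector_def by auto
  thus ?thesis using of_real_hom.eigenvalue_hom[OF N] bound that by blast
qed

section \<open>Entrywise limits\<close>

text \<open>The dimensions \<open>nr\<close> and \<open>nc\<close> are those of all members of the sequence and of its limit.\<close>

definition entrywise_lim ::
  "nat \<Rightarrow> nat \<Rightarrow> (nat \<Rightarrow> 'a :: real_normed_field mat) \<Rightarrow> 'a mat \<Rightarrow> bool" where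
  "entrywise_lim nr nc Xs X \<longleftrightarrow>
     (\<forall>k. Xs k \<in> carrier_mat nr nc) \<and> X \<in> carrier_mat nr nc \<and>
     (\<forall>i<nr. \<forall>j<nc. (\<lambda>k. Xs k $$ (i, j)) \<longlonglongrightarrow> X $$ (i, j))"

lemma entrywise_limI:
  assumes "\<And>k. Xs k \<in> carrier_mat nr nc" and "X \<in> carrier_mat nr nc"
    and "\<And>i j. i < nr \<Longrightarrow> j < nc \<Longrightarrow> (\<lambda>k. Xs k $$ (i, j)) \<longlonglongrightarrow> X $$ (i, j)"
  shows "entrywise_lim nr nc Xs X"
  using assms by (simp add: entrywise_lim_def)

lemma entrywise_limD:
  assumes "entrywise_lim nr nc Xs X"
  shows "Xs k \<in> carrier_mat nr nc" and "X \<in> carrier_mat nr nc"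
    and "i < nr \<Longrightarrow> j < nc \<Longrightarrow> (\<lambda>k. Xs k $$ (i, j)) \<longlonglongrightarrow> X $$ (i, j)"
  using assms by (simp_all add: entrywise_lim_def)

lemma entrywise_lim_const: "X \<in> carrier_mat nr nc \<Longrightarrow> entrywise_lim nr nc (\<lambda>_. X) X"
  by (auto intro: entrywise_limI)

lemma entrywise_lim_add:
  assumes "entrywise_lim nr nc Xs X" and "entrywise_lim nr nc Ys Y"
  shows "entrywise_lim nr nc (\<lambda>k. Xs k + Ys k) (X + Y)"
proof (rule entrywise_limI)
  note X = entrywise_limD[OF assms(1)] and Y = entrywise_limD[OF assms(2)]
  show "\<And>k. Xs k + Ys k \<in> carrier_mat nr nc" "X + Y \<in> carrier_mat nr nc"
    using X Y by auto
  fix i j assume ij: "i < nr" "j < nc"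
  have "(\<lambda>k. Xs k $$ (i, j) + Ys k $$ (i, j)) \<longlonglongrightarrow> X $$ (i, j) + Y $$ (i, j)"
    using X(3) Y(3) ij by (intro tendsto_add)
  moreover have "(Xs k + Ys k) $$ (i, j) = Xs k $$ (i, j) + Ys k $$ (i, j)" for k
    using ij X(1)[of k] Y(1)[of k] by auto
  moreover have "(X + Y) $$ (i, j) = X $$ (i, j) + Y $$ (i, j)"
    using ij X(2) Y(2) by auto
  ultimately show "(\<lambda>k. (Xs k + Ys k) $$ (i, j)) \<longlonglongrightarrow> (X + Y) $$ (i, j)" by simp
qed

lemma entrywise_lim_smult:
  assumes "entrywise_lim nr nc Xs X" and "a \<longlonglongrightarrow> b"
  shows "entrywise_lim nr nc (\<lambda>k. a k \<cdot>\<^sub>m Xs k) (b \<cdot>\<^sub>m X)"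
proof (rule entrywise_limI)
  note X = entrywise_limD[OF assms(1)]
  show "\<And>k. a k \<cdot>\<^sub>m Xs k \<in> carrier_mat nr nc" "b \<cdot>\<^sub>m X \<in> carrier_mat nr nc" using X by auto
  fix i j assume ij: "i < nr" "j < nc"
  have "(\<lambda>k. a k * Xs k $$ (i, j)) \<longlonglongrightarrow> b * X $$ (i, j)"
    using X(3) ij assms(2) by (intro tendsto_mult)
  moreover have "(a k \<cdot>\<^sub>m Xs k) $$ (i, j) = a k * Xs k $$ (i, j)" for k using ij X(1)[of k] by auto
  moreover have "(b \<cdot>\<^sub>m X) $$ (i, j) = b * X $$ (i, j)" using ij X(2) by auto
  ultimately show "(\<lambda>k. (a k \<cdot>\<^sub>m Xs k) $$ (i, j)) \<longlonglongrightarrow> (b \<cdot>\<^sub>m X) $$ (i, j)" by simp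
qed

lemma entrywise_lim_mult:
  assumes "entrywise_lim nr n Xs X" and "entrywise_lim n nc Ys Y"
  shows "entrywise_lim nr nc (\<lambda>k. Xs k * Ys k) (X * Y)"
proof (rule entrywise_limI)
  note X = entrywise_limD[OF assms(1)] and Y = entrywise_limD[OF assms(2)]
  show "\<And>k. Xs k * Ys k \<in> carrier_mat nr nc" "X * Y \<in> carrier_mat nr nc"
    using mult_carrier_mat[OF X(1) Y(1)] mult_carrier_mat[OF X(2) Y(2)] by auto
  fix i j assume ij: "i < nr" "j < nc"
  show "(\<lambda>k. (Xs k * Ys k) $$ (i, j)) \<longlonglongrightarrow> (X * Y) $$ (i, j)"
    unfolding mult_mat_index[OF X(1) Y(1) ij] mult_mat_index[OF X(2) Y(2) ij]
    using X(3) Y(3) ij by (intro tendsto_sum tendsto_mult) auto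
qed

lemma entrywise_lim_mult_vec:
  assumes "entrywise_lim nr nc Xs X" and "v \<in> carrier_vec nc" and "i < nr"
  shows "(\<lambda>k. (Xs k *\<^sub>v v) $ i) \<longlonglongrightarrow> (X *\<^sub>v v) $ i"
proof -
  note X = entrywise_limD[OF assms(1)]
  show ?thesis
    unfolding mult_mat_vec_index[OF X(1) assms(2,3)] mult_mat_vec_index[OF X(2) assms(2,3)]
    using X(3) assms(3) by (intro tendsto_sum tendsto_mult) auto
qed

lemma entrywise_lim_unique:
  assumes "entrywise_lim nr nc Xs X" and "entrywise_lim nr nc Xs Y"
  shows "X = Y"
proof (rule eq_matI)
  note X = entrywise_limD[OF assms(1)] and Y = entrywise_limD[OF assms(2)]
  show "dim_row X = dim_row Y" "dim_col X = dim_col Y" using X(2) Y(2) by auto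
  fix i j assume "i < dim_row Y" "j < dim_col Y"
  thus "X $$ (i, j) = Y $$ (i, j)"
    using X(3)[of i j] Y(3)[of i j] Y(2) by (auto intro: LIMSEQ_unique)
qed

lemma entrywise_lim_of_real:
  assumes "entrywise_lim nr nc Xs X"
  shows "entrywise_lim nr nc (\<lambda>k. map_mat complex_of_real (Xs k)) (map_mat complex_of_real X)"
proof (rule entrywise_limI)
  note X = entrywise_limD[OF assms]
  show "\<And>k. map_mat complex_of_real (Xs k) \<in> carrier_mat nr nc"
    "map_mat complex_of_real X \<in> carrier_mat nr nc" using X by auto
  fix i j assume ij: "i < nr" "j < nc"
  have "(\<lambda>k. complex_of_real (Xs k $$ (i, j))) \<longlonglongrightarrow> complex_of_real (X $$ (i, j))"
    using X(3) ij by (intro tendsto_of_real)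
  moreover have "map_mat complex_of_real (Xs k) $$ (i, j) = complex_of_real (Xs k $$ (i, j))" for k
    using ij X(1)[of k] by auto
  moreover have "map_mat complex_of_real X $$ (i, j) = complex_of_real (X $$ (i, j))"
    using ij X(2) by auto
  ultimately show "(\<lambda>k. map_mat complex_of_real (Xs k) $$ (i, j)) \<longlonglongrightarrow>
    map_mat complex_of_real X $$ (i, j)" by simp
qed

lemma entrywise_lim_det:
  assumes "entrywise_lim n n Xs X"
  shows "(\<lambda>k. det (Xs k)) \<longlonglongrightarrow> det X"
proof -
  note X = entrywise_limD[OF assms]
  show ?thesis
    unfolding det_def'[OF X(1)] det_def'[OF X(2)]
    by (intro tendsto_sum tendsto_mult tendsto_prod tendsto_const X(3))
      (auto simp: permutes_in_image dest: permutes_in_image)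
qed

text \<open>The characteristic polynomial of a matrix whose eigenvalues lie in the disc of radius \<open>r\<close> is at
  least \<open>(\<bar>z\<bar> - r)\<^sup>n\<close> in modulus outside of that disc. This bound passes to the limit, so there is no
  need for the continuity of the individual eigenvalues.\<close>

lemma char_poly_lower_bound:
  fixes A :: "complex mat"
  assumes A: "A \<in> carrier_mat n n" and bound: "\<And>a. eigenvalue A a \<Longrightarrow> cmod a \<le> r"
    and d: "0 \<le> d" "r + d \<le> cmod z"
  shows "d ^ n \<le> cmod (poly (char_poly A) z)"
proof -
  obtain as where as: "char_poly A = (\<Prod>a\<leftarrow>as. [:- a, 1:])" and len: "length as = n"
    using char_poly_factorized[OF A] by blast
  have "cmod a \<le> r" if "a \<in> set as" for a
    using that bound[of a] unfolding eigenvalue_root_char_poly[OF A] as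
    by (auto simp: poly_prod_list o_def prod_list_zero_iff)
  hence "d \<le> cmod (z - a)" if "a \<in> set as" for a
    using that d(2) norm_triangle_ineq2[of z a] by force
  hence "d ^ length as \<le> cmod (poly (\<Prod>a\<leftarrow>as. [:- a, 1:]) z)"
  proof (induction as)
    case (Cons a as)
    hence "d * d ^ length as \<le> cmod (z - a) * cmod (poly (\<Prod>a\<leftarrow>as. [:- a, 1:]) z)"
      using d(1) by (intro mult_mono) auto
    thus ?case by (simp add: norm_mult[symmetric] left_diff_distrib)
  qed simp
  thus ?thesis using as len by simp
qed

lemma eigen_bound_lim:
  assumes lim: "entrywise_lim n n Ns N" and bound: "\<And>k. eigen_bound (Ns k) (r k)" and r: "r \<longlonglongrightarrow> r'"
  shows "eigen_bound N r'"
  unfolding eigen_bound_def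
proof (intro allI impI)
  fix z assume ev: "eigenvalue (map_mat complex_of_real N) z"
  note N = entrywise_limD[OF lim]
  have c: "map_mat complex_of_real (Ns k) \<in> carrier_mat n n"
    "map_mat complex_of_real N \<in> carrier_mat n n" for k
    using N by auto
  show "cmod z \<le> r'"
  proof (rule ccontr)
    assume "\<not> cmod z \<le> r'"
    define d where "d = (cmod z - r') / 2"
    have d: "d > 0" "r' < cmod z - d" using \<open>\<not> cmod z \<le> r'\<close> by (auto simp: d_def field_simps)
    have eq: "- (char_matrix A z) = (- 1) \<cdot>\<^sub>m (A + (- z) \<cdot>\<^sub>m 1\<^sub>m n)" if "A \<in> carrier_mat n n" for A
      using that by (intro eq_matI) (auto simp: char_matrix_def)
    have "(\<lambda>k. poly (char_poly (map_mat complex_of_real (Ns k))) z)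
      \<longlonglongrightarrow> poly (char_poly (map_mat complex_of_real N)) z"
      unfolding char_poly_matrix[OF c(1)] char_poly_matrix[OF c(2)] eq[OF c(1)] eq[OF c(2)]
      by (intro entrywise_lim_det entrywise_lim_smult entrywise_lim_add entrywise_lim_of_real
          entrywise_lim_const tendsto_const) (use lim in auto)
    hence "(\<lambda>k. cmod (poly (char_poly (map_mat complex_of_real (Ns k))) z)) \<longlonglongrightarrow> 0"
      using ev unfolding eigenvalue_root_char_poly[OF c(2)] by (simp add: tendsto_norm_zero)
    moreover have "eventually (\<lambda>k. d ^ n \<le> cmod (poly (char_poly (map_mat complex_of_real (Ns k))) z))
      sequentially"
      using order_tendstoD(2)[OF r d(2)]
    proof eventually_elim
      case (elim k)
      show ?case
        by (rule char_poly_lower_bound[OF c(1), of k "r k"])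
          (use bound[of k] elim d in \<open>auto simp: eigen_bound_def\<close>)
    qed
    ultimately have "d ^ n \<le> 0" by (rule tendsto_lowerbound) simp
    thus False using zero_less_power[OF d(1), of n] by simp
  qed
qed

section \<open>The Riccati iteration\<close>

text \<open>The nonnegative coefficients of \<open>2 s X = X C X + X Q + P X + B\<close>. For \<open>P = s I - A\<close> and \<open>Q = s I - D\<close> this
  is the algebraic Riccati equation \<open>X C X - X D - A X + B = 0\<close>.\<close>

locale nonneg_riccati =
  fixes m n :: nat and P B C Q :: "real mat"
  assumes P: "P \<in> carrier_mat m m" and B: "B \<in> carrier_mat m n"
    and C: "C \<in> carrier_mat n m" and Q: "Q \<in> carrier_mat n n"
    and P0: "0\<^sub>m m m \<le> P" and B0: "0\<^sub>m m n \<le> B" and C0: "0\<^sub>m n m \<le> C" and Q0: "0\<^sub>m n n \<le> Q"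
begin

text \<open>The right-hand side of the equation, divided by \<open>2 t\<close>. The parameter \<open>t\<close> is kept apart from the
  coefficients because the iteration is also run with \<open>t > s\<close> while \<open>P\<close> and \<open>Q\<close> stay fixed.\<close>

definition step :: "real \<Rightarrow> real mat \<Rightarrow> real mat" where
  "step t X = (1 / (2 * t)) \<cdot>\<^sub>m (X * C * X + X * Q + P * X + B)"

text \<open>The \<open>k\<close>-th iterate of \<open>step t\<close> from the zero matrix.\<close>

definition iter :: "real \<Rightarrow> nat \<Rightarrow> real mat" where
  "iter t k = (step t ^^ k) (0\<^sub>m m n)"

lemma iter_0 [simp]: "iter t 0 = 0\<^sub>m m n" and iter_Suc: "iter t (Suc k) = step t (iter t k)"
  by (simp_all add: iter_def)

lemma sum_carrier: "X \<in> carrier_mat m n \<Longrightarrow> X * C * X + X * Q + P * X + B \<in> carrier_mat m n"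
  using B by auto

lemma step_carrier: "X \<in> carrier_mat m n \<Longrightarrow> step t X \<in> carrier_mat m n"
  unfolding step_def using sum_carrier by auto

lemma iter_carrier: "iter t k \<in> carrier_mat m n"
  by (induction k) (simp_all add: iter_Suc step_carrier)

lemma step_mono:
  assumes t: "t > 0" and X: "X \<in> carrier_mat m n" and X0: "0\<^sub>m m n \<le> X" and XY: "X \<le> Y"
  shows "step t X \<le> step t Y"
proof -
  have Y: "Y \<in> carrier_mat m n" using X XY by (auto simp: less_eq_mat_def)
  have XC: "X * C \<in> carrier_mat m m" using X C by auto
  have le1: "X * C * X \<le> Y * C * Y"
    by (rule mult_mat_mono[OF XC X mult_mat_nonneg[OF X C X0 C0]
          mult_mat_mono[OF X C X0 XY C0] X0 XY]) simp
  have le2: "X * Q \<le> Y * Q" by (rule mult_mat_mono[OF X Q X0 XY Q0]) simp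
  have le3: "P * X \<le> P * Y" by (rule mult_mat_mono[OF P X P0 _ X0 XY]) simp
  have "step t X $$ (i, j) \<le> step t Y $$ (i, j)" if ij: "i < m" "j < n" for i j
  proof -
    have "(X * C * X) $$ (i, j) \<le> (Y * C * Y) $$ (i, j)" "(X * Q) $$ (i, j) \<le> (Y * Q) $$ (i, j)"
      "(P * X) $$ (i, j) \<le> (P * Y) $$ (i, j)"
      using le1 le2 le3 X Y P Q ij unfolding less_eq_mat_def by auto
    thus ?thesis using ij t X Y P B C Q unfolding step_def
      by (auto simp del: index_mult_mat(1) intro!: divide_right_mono)
  qed
  thus ?thesis using step_carrier[OF X, of t] step_carrier[OF Y, of t] by (auto simp: less_eq_mat_def)
qed

lemma step_nonneg:
  assumes t: "t > 0" and X: "X \<in> carrier_mat m n" and X0: "0\<^sub>m m n \<le> X"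
  shows "0\<^sub>m m n \<le> step t X"
proof -
  have "0\<^sub>m m n \<le> X * C * X + X * Q + P * X + B"
    using X C P Q B X0 C0 P0 Q0 B0
    by (intro add_mat_nonneg mult_mat_nonneg[of _ m m] mult_mat_nonneg[of _ m n] mult_mat_nonneg) auto
  thus ?thesis using t sum_carrier[OF X] unfolding step_def less_eq_mat_def by auto
qed

lemma iter_nonneg: "t > 0 \<Longrightarrow> 0\<^sub>m m n \<le> iter t k"
  by (induction k) (simp_all add: iter_Suc step_nonneg iter_carrier)

lemma iter_le_fixed_point:
  assumes "t > 0" and "0\<^sub>m m n \<le> Y" and "step t Y = Y"
  shows "iter t k \<le> Y"
proof (induction k)
  case (Suc k)
  thus ?case
    using step_mono[OF assms(1) iter_carrier iter_nonneg[OF assms(1)] Suc] assms(3) by (simp add: iter_Suc)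
qed (simp add: assms)

lemma iter_mono: "t > 0 \<Longrightarrow> iter t k \<le> iter t (Suc k)"
proof (induction k)
  case 0
  thus ?case using iter_nonneg[of t "Suc 0"] by simp
next
  case (Suc k)
  thus ?case unfolding iter_Suc[of t "Suc k"] iter_Suc[of t k]
    using step_mono[OF Suc.prems iter_carrier iter_nonneg] iter_Suc by metis
qed

lemma step_mult_vec_le:
  assumes t: "t > 0" and X: "X \<in> carrier_mat m n" and X0: "0\<^sub>m m n \<le> X"
    and v1: "v1 \<in> carrier_vec n" and v2: "v2 \<in> carrier_vec m"
    and Qv: "Q *\<^sub>v v1 + C *\<^sub>v v2 \<le> t \<cdot>\<^sub>v v1" and Pv: "B *\<^sub>v v1 + P *\<^sub>v v2 \<le> t \<cdot>\<^sub>v v2"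
    and Xv: "X *\<^sub>v v1 \<le> v2"
  shows "step t X *\<^sub>v v1 \<le> v2"
proof -
  define y where "y = X *\<^sub>v v1"
  have y: "y \<in> carrier_vec m" and yv: "y \<le> v2" using X v1 Xv by (auto simp: y_def)
  have Cy: "C *\<^sub>v y \<in> carrier_vec n" "C *\<^sub>v v2 \<in> carrier_vec n" "Q *\<^sub>v v1 \<in> carrier_vec n"
    using C Q by (auto simp: y v2 v1)
  have Cyv: "C *\<^sub>v y \<le> C *\<^sub>v v2" by (rule mult_mat_vec_mono[OF C C0 y yv])
  have "C *\<^sub>v y + Q *\<^sub>v v1 \<le> t \<cdot>\<^sub>v v1"
    using Cyv Qv Cy v1 C Q unfolding less_eq_vec_def by (auto simp del: index_mult_mat_vec) (smt (verit))
  hence "X *\<^sub>v (C *\<^sub>v y + Q *\<^sub>v v1) \<le> X *\<^sub>v (t \<cdot>\<^sub>v v1)"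
    using Cy by (intro mult_mat_vec_mono[OF X X0]) auto
  also have "X *\<^sub>v (t \<cdot>\<^sub>v v1) = t \<cdot>\<^sub>v y" using X v1 by (simp add: y_def mult_mat_vec)
  finally have 1: "X *\<^sub>v (C *\<^sub>v y + Q *\<^sub>v v1) \<le> t \<cdot>\<^sub>v y" .
  have 2: "P *\<^sub>v y \<le> P *\<^sub>v v2" by (rule mult_mat_vec_mono[OF P P0 y yv])
  have c: "X * C * X \<in> carrier_mat m n" "X * Q \<in> carrier_mat m n" "P * X \<in> carrier_mat m n"
    using X C Q P by auto
  have "(X * C * X + X * Q + P * X + B) *\<^sub>v v1 =
      (X * C * X) *\<^sub>v v1 + (X * Q) *\<^sub>v v1 + (P * X) *\<^sub>v v1 + B *\<^sub>v v1"
    using c B v1 mult_mat_vec_carrier[OF c(1) v1] mult_mat_vec_carrier[OF c(2) v1]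
      mult_mat_vec_carrier[OF c(3) v1] mult_mat_vec_carrier[OF B v1]
    by (simp add: add_mult_distrib_mat_vec[of _ m n] assoc_add_vec[of _ m])
  also have "(X * C * X) *\<^sub>v v1 = X *\<^sub>v (C *\<^sub>v y)"
    unfolding y_def using assoc_mult_mat_vec[OF mult_carrier_mat[OF X C] X v1]
      assoc_mult_mat_vec[OF X C, of "X *\<^sub>v v1"] X v1 by simp
  also have "(X * Q) *\<^sub>v v1 = X *\<^sub>v (Q *\<^sub>v v1)" by (rule assoc_mult_mat_vec[OF X Q v1])
  also have "(P * X) *\<^sub>v v1 = P *\<^sub>v y" unfolding y_def by (rule assoc_mult_mat_vec[OF P X v1])
  also have "X *\<^sub>v (C *\<^sub>v y) + X *\<^sub>v (Q *\<^sub>v v1) = X *\<^sub>v (C *\<^sub>v y + Q *\<^sub>v v1)"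
    using X Cy by (simp add: mult_add_distrib_mat_vec[of _ m n])
  finally have eq: "(X * C * X + X * Q + P * X + B) *\<^sub>v v1 =
    X *\<^sub>v (C *\<^sub>v y + Q *\<^sub>v v1) + P *\<^sub>v y + B *\<^sub>v v1" .
  have "(step t X *\<^sub>v v1) $ i \<le> v2 $ i" if i: "i < m" for i
  proof -
    have "(step t X *\<^sub>v v1) $ i =
      1 / (2 * t) * ((X *\<^sub>v (C *\<^sub>v y + Q *\<^sub>v v1)) $ i + (P *\<^sub>v y) $ i + (B *\<^sub>v v1) $ i)"
      unfolding step_def smult_mat_mult_vec[OF sum_carrier[OF X] v1] eq
      using i X P B by (simp del: index_mult_mat_vec)
    also have "\<dots> \<le> 1 / (2 * t) * (2 * t * v2 $ i)"
    proof (rule mult_left_mono)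
      have "(X *\<^sub>v (C *\<^sub>v y + Q *\<^sub>v v1)) $ i \<le> t * y $ i" "y $ i \<le> v2 $ i"
        "(P *\<^sub>v y) $ i \<le> (P *\<^sub>v v2) $ i" "(B *\<^sub>v v1) $ i + (P *\<^sub>v v2) $ i \<le> t * v2 $ i"
        using 1 2 Pv yv i X P B y v2 unfolding less_eq_vec_def by (auto simp del: index_mult_mat_vec)
      moreover have "t * y $ i \<le> t * v2 $ i" using \<open>y $ i \<le> v2 $ i\<close> t by simp
      ultimately show "(X *\<^sub>v (C *\<^sub>v y + Q *\<^sub>v v1)) $ i + (P *\<^sub>v y) $ i + (B *\<^sub>v v1) $ i \<le> 2 * t * v2 $ i"
        by linarith
    qed (use t in simp)
    finally show ?thesis using t by simp
  qed
  thus ?thesis using v2 step_carrier[OF X, of t] by (auto simp: less_eq_vec_def)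
qed

lemma iter_mult_vec_le:
  assumes t: "t > 0" and v1: "v1 \<in> carrier_vec n" and v2: "v2 \<in> carrier_vec m" and "0\<^sub>v m \<le> v2"
    and Qv: "Q *\<^sub>v v1 + C *\<^sub>v v2 \<le> t \<cdot>\<^sub>v v1" and Pv: "B *\<^sub>v v1 + P *\<^sub>v v2 \<le> t \<cdot>\<^sub>v v2"
  shows "iter t k *\<^sub>v v1 \<le> v2"
proof (induction k)
  case 0
  have "0\<^sub>m m n *\<^sub>v v1 = 0\<^sub>v m" using v1 by (intro eq_vecI) auto
  thus ?case using assms by simp
next
  case (Suc k)
  thus ?case unfolding iter_Suc
    by (intro step_mult_vec_le[OF t iter_carrier iter_nonneg[OF t] v1 v2 Qv Pv])
qed

lemma step_lim:
  assumes "entrywise_lim m n Xs X" and "a \<longlonglongrightarrow> t" and "t \<noteq> 0"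
  shows "entrywise_lim m n (\<lambda>k. step (a k) (Xs k)) (step t X)"
  unfolding step_def using assms
  by (intro entrywise_lim_smult entrywise_lim_add entrywise_lim_mult[of m m] entrywise_lim_mult[of m n]
      entrywise_lim_const P B C Q tendsto_intros) auto

lemma iter_parameter_lim:
  assumes "a \<longlonglongrightarrow> t" and "t \<noteq> 0"
  shows "entrywise_lim m n (\<lambda>j. iter (a j) k) (iter t k)"
  by (induction k) (auto simp: iter_Suc intro!: entrywise_lim_const step_lim assms)

text \<open>The iterates increase to the minimal nonnegative fixed point.\<close>

lemma iter_lim:
  assumes t: "t > 0" and \<Phi>: "\<Phi> \<in> carrier_mat m n" and \<Phi>0: "0\<^sub>m m n \<le> \<Phi>" and fixp: "step t \<Phi> = \<Phi>"
    and minimal: "\<And>Y. Y \<in> carrier_mat m n \<Longrightarrow> 0\<^sub>m m n \<le> Y \<Longrightarrow> step t Y = Y \<Longrightarrow> \<Phi> \<le> Y"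
  shows "entrywise_lim m n (iter t) \<Phi>"
proof -
  have le: "iter t k $$ (i, j) \<le> \<Phi> $$ (i, j)" "iter t k $$ (i, j) \<le> iter t (Suc k) $$ (i, j)"
    "0 \<le> iter t k $$ (i, j)" if "i < m" "j < n" for i j k
    using iter_le_fixed_point[OF t \<Phi>0 fixp, of k] iter_mono[OF t, of k] iter_nonneg[OF t, of k] that \<Phi>
      iter_carrier[of t k] iter_carrier[of t "Suc k"] unfolding less_eq_mat_def by auto
  define L where "L = mat m n (\<lambda>(i, j). lim (\<lambda>k. iter t k $$ (i, j)))"
  have L: "L \<in> carrier_mat m n" by (simp add: L_def)
  have lim: "(\<lambda>k. iter t k $$ (i, j)) \<longlonglongrightarrow> L $$ (i, j)" if ij: "i < m" "j < n" for i j
  proof -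
    have "convergent (\<lambda>k. iter t k $$ (i, j))"
      using incseq_convergent[of "\<lambda>k. iter t k $$ (i, j)" "\<Phi> $$ (i, j)"] le[OF ij]
      unfolding incseq_Suc_iff convergent_def by metis
    thus ?thesis using ij by (simp add: L_def convergent_LIMSEQ_iff)
  qed
  have elim: "entrywise_lim m n (iter t) L"
    by (rule entrywise_limI[OF iter_carrier L lim])
  have "entrywise_lim m n (\<lambda>k. iter t (Suc k)) (step t L)"
    unfolding iter_Suc using t by (intro step_lim[OF elim]) auto
  moreover have "entrywise_lim m n (\<lambda>k. iter t (Suc k)) L"
    using lim by (intro entrywise_limI iter_carrier L LIMSEQ_Suc) auto
  ultimately have "step t L = L" by (rule entrywise_lim_unique)
  moreover have "0\<^sub>m m n \<le> L"
    using L LIMSEQ_le_const[OF lim] le(3) by (auto simp: less_eq_mat_def)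
  ultimately have "\<Phi> \<le> L" using minimal L by blast
  moreover have "L \<le> \<Phi>"
    using L \<Phi> LIMSEQ_le_const2[OF lim] le(1) by (auto simp: less_eq_mat_def)
  ultimately have "L = \<Phi>" by (rule antisym[rotated])
  thus ?thesis using elim by simp
qed

end

text \<open>Transposition exchanges \<open>P\<close> with \<open>Q\<close>, so that facts about \<open>X v\<close> become facts about left
  vectors.\<close>

lemma nonneg_riccati_transpose:
  "nonneg_riccati m n P B C Q \<Longrightarrow> nonneg_riccati n m Q\<^sup>T B\<^sup>T C\<^sup>T P\<^sup>T"
  by (simp add: nonneg_riccati_def transpose_mat_nonneg)

lemma (in nonneg_riccati) iter_transpose:
  "nonneg_riccati.iter n m Q\<^sup>T B\<^sup>T C\<^sup>T P\<^sup>T t k = (iter t k)\<^sup>T"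
proof -
  interpret dual: nonneg_riccati n m "Q\<^sup>T" "B\<^sup>T" "C\<^sup>T" "P\<^sup>T"
    by (rule nonneg_riccati_transpose) (rule nonneg_riccati_axioms)
  have step: "dual.step t X\<^sup>T = (step t X)\<^sup>T" if X: "X \<in> carrier_mat m n" for X
  proof -
    have c: "X * C \<in> carrier_mat m m" "X * C * X \<in> carrier_mat m n" "X * Q \<in> carrier_mat m n"
      "P * X \<in> carrier_mat m n" "C * X \<in> carrier_mat n n"
      using X P B C Q by auto
    have "X\<^sup>T * C\<^sup>T * X\<^sup>T = (X * C * X)\<^sup>T"
      using X C transpose_mult[OF X C] transpose_mult[OF c(1) X]
        assoc_mult_mat[of "X\<^sup>T" n m "C\<^sup>T" n "X\<^sup>T" m] by simp
    moreover have "X\<^sup>T * P\<^sup>T = (P * X)\<^sup>T" "Q\<^sup>T * X\<^sup>T = (X * Q)\<^sup>T"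
      using transpose_mult[OF P X] transpose_mult[OF X Q] by auto
    ultimately show ?thesis
      unfolding dual.step_def step_def using X P B C Q
      by (intro eq_matI) auto
  qed
  show ?thesis by (induction k) (auto simp: iter_Suc dual.iter_Suc step iter_carrier)
qed

lemma subinvariant_four_block:
  assumes c: "Q \<in> carrier_mat n n" "C \<in> carrier_mat n m" "B \<in> carrier_mat m n" "P \<in> carrier_mat m m"
    and v: "v1 \<in> carrier_vec n" "v2 \<in> carrier_vec m"
    and sub: "subinvariant (n + m) (four_block_mat Q C B P) s (v1 @\<^sub>v v2)"
  shows "Q *\<^sub>v v1 + C *\<^sub>v v2 \<le> s \<cdot>\<^sub>v v1" and "B *\<^sub>v v1 + P *\<^sub>v v2 \<le> s \<cdot>\<^sub>v v2"
    and "\<And>i. i < n \<Longrightarrow> v1 $ i > 0" and "\<And>i. i < m \<Longrightarrow> v2 $ i > 0"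
proof -
  have le: "(Q *\<^sub>v v1 + C *\<^sub>v v2) @\<^sub>v (B *\<^sub>v v1 + P *\<^sub>v v2) \<le> s \<cdot>\<^sub>v (v1 @\<^sub>v v2)"
    using sub four_block_mat_mult_vec[OF c v] by (auto simp: subinvariant_def)
  have "s \<cdot>\<^sub>v (v1 @\<^sub>v v2) = (s \<cdot>\<^sub>v v1) @\<^sub>v (s \<cdot>\<^sub>v v2)"
    by (intro eq_vecI) auto
  with le show "Q *\<^sub>v v1 + C *\<^sub>v v2 \<le> s \<cdot>\<^sub>v v1" "B *\<^sub>v v1 + P *\<^sub>v v2 \<le> s \<cdot>\<^sub>v v2"
    using append_vec_le[of "Q *\<^sub>v v1 + C *\<^sub>v v2" n "s \<cdot>\<^sub>v v1" "B *\<^sub>v v1 + P *\<^sub>v v2" "s \<cdot>\<^sub>v v2"] c v by auto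
  have pos: "(v1 @\<^sub>v v2) $ i > 0" if "i < n + m" for i using sub that by (auto simp: subinvariant_def)
  show "v1 $ i > 0" if "i < n" for i using pos[of i] that v by auto
  show "v2 $ i > 0" if "i < m" for i using pos[of "n + i"] that v by auto
qed

context nonneg_riccati
begin

context
  fixes s :: real and v :: "real vec" and \<Phi> :: "real mat"
  assumes s: "s > 0"
    and sub: "subinvariant (n + m) (four_block_mat Q C B P) s v"
    and \<Phi>: "\<Phi> \<in> carrier_mat m n" and \<Phi>0: "0\<^sub>m m n \<le> \<Phi>" and fixp: "step s \<Phi> = \<Phi>"
    and minimal: "\<And>Y. Y \<in> carrier_mat m n \<Longrightarrow> 0\<^sub>m m n \<le> Y \<Longrightarrow> step s Y = Y \<Longrightarrow> \<Phi> \<le> Y"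
begin

lemma right_closed_loop_subinvariant: "subinvariant n (Q + C * \<Phi>) s (vec_first v n)"
proof -
  define v1 where "v1 = vec_first v n"
  define v2 where "v2 = vec_last v m"
  have v: "v1 \<in> carrier_vec n" "v2 \<in> carrier_vec m" and "v = v1 @\<^sub>v v2"
    using sub by (auto simp: v1_def v2_def subinvariant_def)
  note le = subinvariant_four_block[OF Q C B P v sub[unfolded \<open>v = v1 @\<^sub>v v2\<close>]]
  have v20: "0\<^sub>v m \<le> v2" using le(4) v(2) by (auto simp: less_eq_vec_def less_imp_le)
  note lim = iter_lim[OF s \<Phi> \<Phi>0 fixp minimal]
  have "(\<Phi> *\<^sub>v v1) $ i \<le> v2 $ i" if i: "i < m" for i
    using iter_mult_vec_le[OF s v v20 le(1,2)] i v(2) unfolding less_eq_vec_def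
    by (intro LIMSEQ_le_const2[OF entrywise_lim_mult_vec[OF lim v(1) i]]) (auto simp del: index_mult_mat_vec)
  hence "\<Phi> *\<^sub>v v1 \<le> v2" using \<Phi> v by (auto simp: less_eq_vec_def)
  hence *: "C *\<^sub>v (\<Phi> *\<^sub>v v1) \<le> C *\<^sub>v v2"
    using \<Phi> v by (intro mult_mat_vec_mono[OF C C0]) auto
  have "(Q + C * \<Phi>) *\<^sub>v v1 = Q *\<^sub>v v1 + C *\<^sub>v (\<Phi> *\<^sub>v v1)"
    using Q C \<Phi> v by (simp add: add_mult_distrib_mat_vec[of _ n n] assoc_mult_mat_vec[of _ n m])
  moreover have "\<dots> \<le> s \<cdot>\<^sub>v v1"
    using * le(1) Q C v unfolding less_eq_vec_def
    by (auto simp del: index_mult_mat_vec) (smt (verit))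
  ultimately show ?thesis
    using v le(3) by (auto simp: subinvariant_def v1_def)
qed

text \<open>Bounding \<open>P + \<Phi> C\<close> in the same way requires a positive left vector \<open>u\<close>. There is one for
  every \<open>t > s\<close>, and it controls the iterates with parameter \<open>t\<close>. The bound then passes to the
  limit \<open>t \<rightarrow> s\<close> for a fixed number of iterations, and after that to the limit of the iterates.\<close>

lemma left_closed_loop_eigen_bound: "eigen_bound (P + \<Phi> * C) s"
proof -
  interpret dual: nonneg_riccati n m "Q\<^sup>T" "B\<^sup>T" "C\<^sup>T" "P\<^sup>T"
    by (rule nonneg_riccati_transpose) (rule nonneg_riccati_axioms)
  have K: "four_block_mat Q C B P \<in> carrier_mat (n + m) (n + m)" using Q P by auto
  have K0: "0\<^sub>m (n + m) (n + m) \<le> four_block_mat Q C B P"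
    using P B C Q P0 B0 C0 Q0 by (auto simp: less_eq_mat_def)
  have bound: "eigen_bound (P + iter t k * C) t" if ts: "t > s" for t k
  proof -
    have t: "t > 0" using ts s by simp
    obtain u where u: "subinvariant (n + m) (four_block_mat Q C B P)\<^sup>T t u"
      using subinvariant_transpose[OF sub K K0 ts] by blast
    define u1 where "u1 = vec_first u n"
    define u2 where "u2 = vec_last u m"
    have uc: "u1 \<in> carrier_vec n" "u2 \<in> carrier_vec m" and "u = u1 @\<^sub>v u2"
      using u by (auto simp: u1_def u2_def subinvariant_def)
    have c: "Q\<^sup>T \<in> carrier_mat n n" "B\<^sup>T \<in> carrier_mat n m" "C\<^sup>T \<in> carrier_mat m n" "P\<^sup>T \<in> carrier_mat m m"
      using P B C Q by auto
    note le = subinvariant_four_block[OF c uc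
        u[unfolded \<open>u = u1 @\<^sub>v u2\<close> transpose_four_block_mat[OF Q C B P]]]
    have comm: "P\<^sup>T *\<^sub>v u2 + C\<^sup>T *\<^sub>v u1 = C\<^sup>T *\<^sub>v u1 + P\<^sup>T *\<^sub>v u2"
      "B\<^sup>T *\<^sub>v u2 + Q\<^sup>T *\<^sub>v u1 = Q\<^sup>T *\<^sub>v u1 + B\<^sup>T *\<^sub>v u2"
      by (rule comm_add_vec[of _ m], use P C uc in auto) (rule comm_add_vec[of _ n], use Q B uc in auto)
    define X where "X = iter t k"
    have X: "X \<in> carrier_mat m n" and X0: "0\<^sub>m m n \<le> X"
      using iter_carrier iter_nonneg[OF t] by (auto simp: X_def)
    have "dual.iter t k *\<^sub>v u2 \<le> u1"
      using le uc comm by (intro dual.iter_mult_vec_le[OF t]) (auto simp: less_eq_vec_def less_imp_le)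
    hence *: "C\<^sup>T *\<^sub>v (X\<^sup>T *\<^sub>v u2) \<le> C\<^sup>T *\<^sub>v u1"
      using X uc by (intro mult_mat_vec_mono[OF c(3) transpose_mat_nonneg[OF C C0]])
        (auto simp: iter_transpose X_def)
    have "(P + X * C)\<^sup>T = P\<^sup>T + C\<^sup>T * X\<^sup>T"
      using P X C by (simp add: transpose_add[of _ m m] transpose_mult[of _ m n])
    hence "(P + X * C)\<^sup>T *\<^sub>v u2 = P\<^sup>T *\<^sub>v u2 + C\<^sup>T *\<^sub>v (X\<^sup>T *\<^sub>v u2)"
      using add_mult_distrib_mat_vec[OF c(4) mult_carrier_mat[OF c(3), of "X\<^sup>T" m] uc(2)]
        assoc_mult_mat_vec[OF c(3), of "X\<^sup>T" m u2] X uc by simp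
    also have "\<dots> \<le> t \<cdot>\<^sub>v u2"
    proof -
      have "(P\<^sup>T *\<^sub>v u2 + C\<^sup>T *\<^sub>v (X\<^sup>T *\<^sub>v u2)) $ i \<le> (t \<cdot>\<^sub>v u2) $ i" if i: "i < m" for i
      proof -
        have "(C\<^sup>T *\<^sub>v (X\<^sup>T *\<^sub>v u2)) $ i \<le> (C\<^sup>T *\<^sub>v u1) $ i"
          using * i C unfolding less_eq_vec_def by (simp del: index_mult_mat_vec)
        moreover have "(C\<^sup>T *\<^sub>v u1 + P\<^sup>T *\<^sub>v u2) $ i \<le> (t \<cdot>\<^sub>v u2) $ i"
          using le(2) i uc P unfolding less_eq_vec_def by (auto simp del: index_mult_mat_vec)
        ultimately show ?thesis using i P C by (simp del: index_mult_mat_vec)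
      qed
      thus ?thesis using P C uc unfolding less_eq_vec_def by (simp del: index_mult_mat_vec)
    qed
    finally have "subinvariant m (P + X * C)\<^sup>T t u2"
      using uc le(4) by (auto simp: subinvariant_def)
    moreover have "P + X * C \<in> carrier_mat m m" "0\<^sub>m m m \<le> P + X * C"
      using P X C P0 X0 C0 by (auto intro!: add_mat_nonneg mult_mat_nonneg)
    ultimately show ?thesis
      using eigen_bound_transpose subinvariant_eigen_bound transpose_mat_nonneg
      unfolding X_def by (metis transpose_carrier_mat)
  qed
  \<comment> \<open>A sequence of parameters that decreases strictly to \<open>s\<close>.\<close>
  define a where "a = (\<lambda>j. s + inverse (real (Suc j)))"
  have a: "a \<longlonglongrightarrow> s"
    unfolding a_def using tendsto_add[OF tendsto_const LIMSEQ_inverse_real_of_nat, of s] by simp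
  have "eigen_bound (P + iter s k * C) s" for k
  proof (rule eigen_bound_lim[OF _ _ a])
    show "entrywise_lim m m (\<lambda>j. P + iter (a j) k * C) (P + iter s k * C)"
      using s a by (intro entrywise_lim_add entrywise_lim_mult[of m n] entrywise_lim_const iter_parameter_lim P C) auto
    show "eigen_bound (P + iter (a j) k * C) (a j)" for j
      by (rule bound) (simp add: a_def)
  qed
  moreover have "entrywise_lim m m (\<lambda>k. P + iter s k * C) (P + \<Phi> * C)"
    by (intro entrywise_lim_add entrywise_lim_mult[of m n] entrywise_lim_const P C
        iter_lim[OF s \<Phi> \<Phi>0 fixp minimal]) auto
  ultimately show ?thesis by (rule eigen_bound_lim[OF _ _ tendsto_const, rotated])
qed

end

end

section \<open>The spectrum of the Hamiltonian matrix\<close>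

lemma char_poly_lower_block_triangular:
  fixes A1 :: "'a :: idom mat"
  assumes A1: "A1 \<in> carrier_mat n n" and A3: "A3 \<in> carrier_mat m n" and A4: "A4 \<in> carrier_mat m m"
  shows "char_poly (four_block_mat A1 (0\<^sub>m n m) A3 A4) = char_poly A1 * char_poly A4"
proof -
  have "char_poly_matrix (four_block_mat A1 (0\<^sub>m n m) A3 A4) =
    four_block_mat (char_poly_matrix A1) (0\<^sub>m n m) (map_mat (\<lambda>a. [:- a:]) A3) (char_poly_matrix A4)"
    unfolding char_poly_matrix_def using A1 A3 A4 by (intro eq_matI) (auto simp: one_poly_def)
  thus ?thesis
    unfolding char_poly_def using A1 A3 A4
    by (simp add: det_four_block_mat_upper_right_zero[of _ n _ m])
qed

lemma char_poly_upper_block_triangular: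
  fixes A1 :: "'a :: idom mat"
  assumes A1: "A1 \<in> carrier_mat n n" and A2: "A2 \<in> carrier_mat n m" and A4: "A4 \<in> carrier_mat m m"
  shows "char_poly (four_block_mat A1 A2 (0\<^sub>m m n) A4) = char_poly A1 * char_poly A4"
proof -
  have "char_poly (four_block_mat A1 A2 (0\<^sub>m m n) A4)\<^sup>T = char_poly (four_block_mat A1 A2 (0\<^sub>m m n) A4)"
    using A1 A4 by (intro char_poly_transpose_mat[of _ "n + m"]) auto
  moreover have "(four_block_mat A1 A2 (0\<^sub>m m n) A4)\<^sup>T = four_block_mat A1\<^sup>T (0\<^sub>m n m) A2\<^sup>T A4\<^sup>T"
    using A1 A2 A4 by (subst transpose_four_block_mat) auto
  moreover have "char_poly (four_block_mat A1\<^sup>T (0\<^sub>m n m) A2\<^sup>T A4\<^sup>T) = char_poly A1 * char_poly A4"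
    using char_poly_lower_block_triangular[of "A1\<^sup>T" n "A2\<^sup>T" m "A4\<^sup>T"] A1 A2 A4
      char_poly_transpose_mat[OF A1] char_poly_transpose_mat[OF A4] by simp
  ultimately show ?thesis by simp
qed

lemma char_poly_uminus:
  fixes A :: "'a :: field mat"
  assumes A: "A \<in> carrier_mat n n"
  shows "char_poly (- A) = Polynomial.smult ((- 1) ^ n) (pcompose (char_poly A) [:0, - 1:])"
proof -
  have hom: "comm_ring_hom (\<lambda>p :: 'a poly. pcompose p [:0, - 1:])"
    by unfold_locales (auto simp: pcompose_add pcompose_mult)
  have "char_poly_matrix (- A) = - 1 \<cdot>\<^sub>m map_mat (\<lambda>p. pcompose p [:0, - 1:]) (char_poly_matrix A)"
    unfolding char_poly_matrix_def using A
    by (intro eq_matI) (auto simp: pcompose_pCons pcompose_add pcompose_mult)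
  hence "char_poly (- A) = (- 1) ^ n * (pcompose (char_poly A) [:0, - 1:])"
    unfolding char_poly_def
    using carrier_matD[OF char_poly_matrix_closed[OF A]] by (simp add: det_smult comm_ring_hom.hom_det[OF hom])
  also have "(- 1 :: 'a poly) ^ n = [:(- 1) ^ n:]"
    by (simp add: one_pCons poly_const_pow[symmetric])
  finally show ?thesis by simp
qed

lemma proots_reflect:
  fixes as :: "complex list"
  shows "proots (pcompose (\<Prod>a\<leftarrow>as. [:- a, 1:]) [:0, - 1:]) = image_mset uminus (mset as)"
proof (induction as)
  case Nil
  show ?case by (simp add: pcompose_const one_pCons)
next
  case (Cons a as)
  have "(\<Prod>a\<leftarrow>as. [:- a, 1:]) \<noteq> 0" by (auto simp: prod_list_zero_iff)
  hence nz: "pcompose (\<Prod>a\<leftarrow>as. [:- a, 1:]) [:0, - 1:] \<noteq> 0"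
    by (subst pcompose_eq_0_iff) auto
  have factor: "pcompose [:- a, 1:] [:0, - 1:] = - [:a, 1:]" by (simp add: pcompose_pCons)
  have nz': "- [:a, 1:] \<noteq> 0" by simp
  have "proots (- [:a, 1:]) = {#- a#}" by (simp only: proots_uminus proots_linear_factor)
  thus ?case using proots_mult[OF nz' nz] Cons
    unfolding list.map prod_list.Cons pcompose_mult factor by simp
qed

lemma proots_linear_factors:
  fixes as :: "complex list"
  shows "proots (\<Prod>a\<leftarrow>as. [:- a, 1:]) = mset as"
proof (induction as)
  case (Cons a as)
  have "(\<Prod>a\<leftarrow>as. [:- a, 1:]) \<noteq> 0" by (auto simp: prod_list_zero_iff)
  thus ?case using Cons by (simp add: proots_mult del: mult_pCons_left)
qed simp

lemma char_poly_nonzero: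
  fixes A :: "complex mat"
  assumes "A \<in> carrier_mat n n"
  shows "char_poly A \<noteq> 0"
  using degree_monic_char_poly[OF assms] by auto

lemma eigenvalue_mset_iff:
  assumes "A \<in> carrier_mat n n"
  shows "z \<in># eigenvalue_mset A \<longleftrightarrow> eigenvalue (map_mat complex_of_real A) z"
proof -
  have c: "map_mat complex_of_real A \<in> carrier_mat n n" using assms by auto
  show ?thesis unfolding eigenvalue_mset_def eigenvalue_root_char_poly[OF c]
    using char_poly_nonzero[OF c] by simp
qed

lemma size_eigenvalue_mset:
  assumes "A \<in> carrier_mat n n"
  shows "size (eigenvalue_mset A) = n"
proof -
  have c: "map_mat complex_of_real A \<in> carrier_mat n n" using assms by auto
  show ?thesis unfolding eigenvalue_mset_def size_proots_complex using degree_monic_char_poly[OF c] by simp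
qed

lemma eigenvalue_mset_uminus:
  assumes "A \<in> carrier_mat n n"
  shows "eigenvalue_mset (- A) = image_mset uminus (eigenvalue_mset A)"
proof -
  have c: "map_mat complex_of_real A \<in> carrier_mat n n" using assms by auto
  have eq: "map_mat complex_of_real (- A) = - map_mat complex_of_real A" by (intro eq_matI) auto
  obtain as where as: "char_poly (map_mat complex_of_real A) = (\<Prod>a\<leftarrow>as. [:- a, 1:])"
    using char_poly_factorized[OF c] by blast
  show ?thesis
    unfolding eigenvalue_mset_def eq char_poly_uminus[OF c] unfolding as
    by (simp add: proots_reflect proots_linear_factors)
qed

lemma eigenvalue_mset_similar:
  assumes "similar_mat A B"
  shows "eigenvalue_mset A = eigenvalue_mset B"
proof -
  obtain n P Q where "{A, B, P, Q} \<subseteq> carrier_mat n n" using similar_matD[OF assms] by blast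
  hence c: "A \<in> carrier_mat n n" "B \<in> carrier_mat n n" by auto
  show ?thesis unfolding eigenvalue_mset_def
    using of_real_hom.char_poly_hom[OF c(1)] of_real_hom.char_poly_hom[OF c(2)] char_poly_similar[OF assms]
    by metis
qed

lemma eigenvalue_mset_mult:
  assumes "X \<in> carrier_mat k k" and "A \<in> carrier_mat n n" and "B \<in> carrier_mat m m"
    and "char_poly X = char_poly A * char_poly B"
  shows "eigenvalue_mset X = eigenvalue_mset A + eigenvalue_mset B"
proof -
  have c: "map_mat complex_of_real A \<in> carrier_mat n n" "map_mat complex_of_real B \<in> carrier_mat m m"
    using assms by auto
  interpret map_poly_hom: map_poly_comm_ring_hom complex_of_real ..
  have "char_poly (map_mat complex_of_real X) =
    char_poly (map_mat complex_of_real A) * char_poly (map_mat complex_of_real B)"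
    using assms by (simp add: of_real_hom.char_poly_hom map_poly_hom.hom_mult)
  thus ?thesis unfolding eigenvalue_mset_def
    using char_poly_nonzero[OF c(1)] char_poly_nonzero[OF c(2)] by (simp add: proots_mult)
qed

text \<open>A solution \<open>X\<close> of the Riccati equation gives the invariant subspace of the Hamiltonian that is
  spanned by the columns of \<open>(I, X)\<close>. The matrix acts on it as \<open>D - C X\<close>, and on the quotient as
  \<open>- (A - X C)\<close>.\<close>

lemma hamiltonian_eigenvalues:
  assumes A: "A \<in> carrier_mat m m" and B: "B \<in> carrier_mat m n" and C: "C \<in> carrier_mat n m"
    and D: "D \<in> carrier_mat n n" and X: "X \<in> carrier_mat m n"
    and ric: "X * C * X - X * D - A * X + B = 0\<^sub>m m n"
  shows "eigenvalue_mset (four_block_mat D (- C) B (- A)) =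
    eigenvalue_mset (D - C * X) + image_mset uminus (eigenvalue_mset (A - X * C))"
proof -
  let ?H = "four_block_mat D (- C) B (- A)"
  let ?T = "four_block_mat (D - C * X) (- C) (0\<^sub>m m n) (- (A - X * C))"
  let ?S = "four_block_mat (1\<^sub>m n) (0\<^sub>m n m) X (1\<^sub>m m)"
  let ?S' = "four_block_mat (1\<^sub>m n) (0\<^sub>m n m) (- X) (1\<^sub>m m)"
  have CX: "C * X \<in> carrier_mat n n" and XC: "X * C \<in> carrier_mat m m" using C X by auto
  have inv: "?S * ?S' = 1\<^sub>m (n + m)" "?S' * ?S = 1\<^sub>m (n + m)"
    using X by (subst mult_four_block_mat[of _ n n _ m _ m _ _ n _ m]; auto intro!: eq_matI)+
  have "?H * ?S = four_block_mat (D - C * X) (- C) (B - A * X) (- A)"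
    using A B C D X CX
    by (subst mult_four_block_mat[of _ n n _ m _ m _ _ n _ m])
      (auto intro!: cong_four_block_mat eq_matI)
  moreover have "?S * ?T = four_block_mat (D - C * X) (- C) (B - A * X) (- A)"
  proof -
    have "X * (D - C * X) = B - A * X"
    proof (rule eq_matI)
      fix i j assume "i < dim_row (B - A * X)" "j < dim_col (B - A * X)"
      hence ij: "i < m" "j < n" using A X by auto
      have "(X * C * X - X * D - A * X + B) $$ (i, j) = 0" using ric ij by simp
      moreover have "X * (D - C * X) = X * D - X * C * X"
        using X C D CX by (simp add: mult_minus_distrib_mat[of _ m n] assoc_mult_mat[of _ m n])
      ultimately show "(X * (D - C * X)) $$ (i, j) = (B - A * X) $$ (i, j)"
        using A B C D X XC ij by (auto simp del: index_mult_mat(1))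
    qed (use A B C X in auto)
    moreover have "X * (- C) + - (A - X * C) = - A"
      using A X C XC by (intro eq_matI) auto
    ultimately show ?thesis
      using A B C D X CX XC
      by (subst mult_four_block_mat[of _ n n _ m _ m _ _ n _ m])
        (auto intro!: cong_four_block_mat)
  qed
  ultimately have HS: "?H * ?S = ?S * ?T" by simp
  have c: "?H \<in> carrier_mat (n + m) (n + m)" "?S \<in> carrier_mat (n + m) (n + m)"
    "?S' \<in> carrier_mat (n + m) (n + m)" "?T \<in> carrier_mat (n + m) (n + m)"
    using A B C D X CX XC by auto
  have d: "D - C * X \<in> carrier_mat n n" "- C \<in> carrier_mat n m" "- (A - X * C) \<in> carrier_mat m m"
    using C minus_carrier_mat[OF CX, of D] minus_carrier_mat[OF XC, of A] by auto
  have "?H = ?H * (?S * ?S')" unfolding inv(1) using right_mult_one_mat[OF c(1)] by simp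
  also have "\<dots> = ?S * ?T * ?S'" using HS assoc_mult_mat[OF c(1-3)] by simp
  finally have "similar_mat ?H ?T"
    unfolding similar_mat_def by (intro exI) (rule similar_mat_witI[OF inv _ c(1,4,2,3)])
  hence "eigenvalue_mset ?H = eigenvalue_mset ?T" by (rule eigenvalue_mset_similar)
  also have "\<dots> = eigenvalue_mset (D - C * X) + eigenvalue_mset (- (A - X * C))"
    by (rule eigenvalue_mset_mult[OF c(4) d(1,3) char_poly_upper_block_triangular[OF d]])
  also have "eigenvalue_mset (- (A - X * C)) = image_mset uminus (eigenvalue_mset (A - X * C))"
    by (rule eigenvalue_mset_uminus) (rule minus_carrier_mat[OF XC])
  finally show ?thesis .
qed


lemma similar_mat_swap_blocks:
  fixes A1 :: "'a :: comm_ring_1 mat"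
  assumes A1: "A1 \<in> carrier_mat n n" and A2: "A2 \<in> carrier_mat n m"
    and A3: "A3 \<in> carrier_mat m n" and A4: "A4 \<in> carrier_mat m m"
  shows "similar_mat (four_block_mat A1 A2 A3 A4) (four_block_mat A4 A3 A2 A1)"
proof -
  let ?X = "four_block_mat A1 A2 A3 A4" and ?Y = "four_block_mat A4 A3 A2 A1"
  let ?S = "four_block_mat (0\<^sub>m n m :: 'a mat) (1\<^sub>m n) (1\<^sub>m m) (0\<^sub>m m n)"
  let ?S' = "four_block_mat (0\<^sub>m m n :: 'a mat) (1\<^sub>m m) (1\<^sub>m n) (0\<^sub>m n m)"
  have c: "?X \<in> carrier_mat (n + m) (n + m)" "?Y \<in> carrier_mat (n + m) (n + m)"
    "?S \<in> carrier_mat (n + m) (n + m)" "?S' \<in> carrier_mat (n + m) (n + m)"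
    using A1 A4 by (auto simp: add.commute)
  have one: "1\<^sub>m k * 1\<^sub>m k = (1\<^sub>m k :: 'a mat)" "0\<^sub>m k k + 1\<^sub>m k = (1\<^sub>m k :: 'a mat)"
    "1\<^sub>m k + 0\<^sub>m k k = (1\<^sub>m k :: 'a mat)" for k
    by (rule left_mult_one_mat left_add_zero_mat right_add_zero_mat, rule one_carrier_mat)+
  have inv: "?S * ?S' = 1\<^sub>m (n + m)" "?S' * ?S = 1\<^sub>m (n + m)"
  proof -
    show "?S * ?S' = 1\<^sub>m (n + m)"
      by (subst mult_four_block_mat[of _ n m _ n _ m _ _ n _ m]) (auto simp: one)
    show "?S' * ?S = 1\<^sub>m (n + m)"
      by (subst mult_four_block_mat[of _ m n _ m _ n _ _ m _ n]) (auto simp: one add.commute)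
  qed
  have "?S * ?Y = four_block_mat A2 A1 A4 A3"
    using A1 A2 A3 A4 by (subst mult_four_block_mat[of _ n m _ n _ m _ _ m _ n]) auto
  moreover have "four_block_mat A2 A1 A4 A3 * ?S' = ?X"
    using A1 A2 A3 A4 by (subst mult_four_block_mat[of _ n m _ n _ m _ _ n _ m]) auto
  ultimately have "?X = ?S * ?Y * ?S'" by simp
  thus ?thesis unfolding similar_mat_def using similar_mat_witI[OF inv _ c] by blast
qed

section \<open>Eigenvalues of Z-matrices\<close>

lemma eigenvalue_shift:
  assumes N: "N \<in> carrier_mat n n"
  shows "eigenvalue (map_mat complex_of_real (s \<cdot>\<^sub>m 1\<^sub>m n - N)) z \<longleftrightarrow>
    eigenvalue (map_mat complex_of_real N) (complex_of_real s - z)"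
proof -
  let ?N = "map_mat complex_of_real N" and ?M = "map_mat complex_of_real (s \<cdot>\<^sub>m 1\<^sub>m n - N)"
  have c: "?N \<in> carrier_mat n n" using N by auto
  have M: "?M = complex_of_real s \<cdot>\<^sub>m 1\<^sub>m n - ?N" using N by (intro eq_matI) auto
  have "?M *\<^sub>v x = z \<cdot>\<^sub>v x \<longleftrightarrow> ?N *\<^sub>v x = (complex_of_real s - z) \<cdot>\<^sub>v x" if x: "x \<in> carrier_vec n" for x
  proof -
    have "?M *\<^sub>v x = complex_of_real s \<cdot>\<^sub>v x - ?N *\<^sub>v x" unfolding M by (rule shifted_mult_vec[OF c x])
    hence Mi: "(?M *\<^sub>v x) $ i = complex_of_real s * x $ i - (?N *\<^sub>v x) $ i" if "i < n" for i
      using that x N by (simp del: index_mult_mat_vec)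
    have d: "dim_vec (?M *\<^sub>v x) = n" "dim_vec (?N *\<^sub>v x) = n" "dim_vec x = n"
      using N x by auto
    show ?thesis using Mi unfolding vec_eq_iff d
      by (auto simp del: index_mult_mat_vec simp: d left_diff_distrib)
        (metis add_diff_cancel_left' diff_diff_eq2 diff_add_cancel)+
  qed
  thus ?thesis using N unfolding eigenvalue_def eigenvector_def by auto
qed

text \<open>The disc of radius \<open>s\<close> around \<open>s\<close> touches the imaginary axis at \<open>0\<close> only.\<close>

lemma shifted_eigenvalues:
  assumes N: "N \<in> carrier_mat n n" and bound: "eigen_bound N s" and s: "s > 0"
    and z: "z \<in># eigenvalue_mset (s \<cdot>\<^sub>m 1\<^sub>m n - N)"
  shows "Re z > 0 \<or> z = 0"
proof -
  have "cmod (complex_of_real s - z) \<le> s"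
    using z bound eigenvalue_shift[OF N] eigenvalue_mset_iff[of "s \<cdot>\<^sub>m 1\<^sub>m n - N" n]
      minus_carrier_mat[OF N] unfolding eigen_bound_def by blast
  hence "(cmod (complex_of_real s - z))\<^sup>2 \<le> s\<^sup>2" using s by (intro power_mono) auto
  hence le: "(Re z)\<^sup>2 + (Im z)\<^sup>2 \<le> 2 * s * Re z"
    unfolding cmod_power2 by (simp add: power2_eq_square algebra_simps)
  show ?thesis
  proof (cases "Re z > 0")
    case False
    hence "2 * s * Re z \<le> 0" using s by (simp add: mult_nonneg_nonpos)
    hence "(Re z)\<^sup>2 + (Im z)\<^sup>2 \<le> 0" using le by linarith
    hence "z = 0" by (simp add: complex_eq_iff sum_power2_le_zero_iff)
    thus ?thesis by simp
  qed simp
qed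

lemma shifted_dominant_eigenvalue:
  assumes sub: "subinvariant n N s v" and N: "N \<in> carrier_mat n n" and N0: "0\<^sub>m n n \<le> N"
    and n: "n > 0"
  obtains x :: real where "complex_of_real x \<in># eigenvalue_mset (s \<cdot>\<^sub>m 1\<^sub>m n - N)"
    and "\<And>z. z \<in># eigenvalue_mset (s \<cdot>\<^sub>m 1\<^sub>m n - N) \<Longrightarrow> x \<le> Re z"
    and "\<And>z. z \<in># eigenvalue_mset (s \<cdot>\<^sub>m 1\<^sub>m n - N) \<Longrightarrow> Re z = x \<Longrightarrow> z = complex_of_real x"
proof -
  obtain r where r: "eigenvalue (map_mat complex_of_real N) (complex_of_real r)" "eigen_bound N r"
    using dominant_eigenvalue_exists[OF sub N N0 n] .
  note iff = eigenvalue_mset_iff[OF minus_carrier_mat[OF N, of "s \<cdot>\<^sub>m 1\<^sub>m n"]] eigenvalue_shift[OF N]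
  have bound: "cmod (complex_of_real s - z) \<le> r" if "z \<in># eigenvalue_mset (s \<cdot>\<^sub>m 1\<^sub>m n - N)" for z
    using that r(2) iff unfolding eigen_bound_def by blast
  show ?thesis
  proof (rule that[of "s - r"])
    show "complex_of_real (s - r) \<in># eigenvalue_mset (s \<cdot>\<^sub>m 1\<^sub>m n - N)"
      unfolding iff using r(1) by simp
    fix z assume z: "z \<in># eigenvalue_mset (s \<cdot>\<^sub>m 1\<^sub>m n - N)"
    show "s - r \<le> Re z"
      using bound[OF z] complex_Re_le_cmod[of "complex_of_real s - z"] by simp
    assume Re: "Re z = s - r"
    have "(cmod (complex_of_real s - z))\<^sup>2 \<le> r\<^sup>2" using bound[OF z] by (intro power_mono) auto
    hence "(Im z)\<^sup>2 \<le> 0" using Re by (simp add: cmod_power2)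
    thus "z = complex_of_real (s - r)" using Re by (simp add: complex_eq_iff)
  qed
qed

section \<open>The closed-loop matrices\<close>

text \<open>The assumptions on \<open>A\<close>, \<open>B\<close>, \<open>C\<close>, \<open>D\<close> and the vectors are what a regular M-matrix with
  diagonal blocks \<open>D\<close>, \<open>A\<close> and off-diagonal blocks \<open>- C\<close>, \<open>- B\<close> provides. In this form they are
  visibly symmetric under exchanging \<open>(A, B)\<close> with \<open>(D, C)\<close>.\<close>

lemma closed_loop_spectra:
  fixes A B C D \<Phi> :: "real mat"
  assumes n: "n > 0"
    and A: "A \<in> carrier_mat m m" and B: "B \<in> carrier_mat m n"
    and C: "C \<in> carrier_mat n m" and D: "D \<in> carrier_mat n n"
    and offA: "\<And>i j. i < m \<Longrightarrow> j < m \<Longrightarrow> i \<noteq> j \<Longrightarrow> A $$ (i, j) \<le> 0"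
    and offD: "\<And>i j. i < n \<Longrightarrow> j < n \<Longrightarrow> i \<noteq> j \<Longrightarrow> D $$ (i, j) \<le> 0"
    and B0: "0\<^sub>m m n \<le> B" and C0: "0\<^sub>m n m \<le> C"
    and v1: "v1 \<in> carrier_vec n" and v2: "v2 \<in> carrier_vec m"
    and pos: "\<And>i. i < n \<Longrightarrow> v1 $ i > 0" "\<And>i. i < m \<Longrightarrow> v2 $ i > 0"
    and Dv: "C *\<^sub>v v2 \<le> D *\<^sub>v v1" and Av: "B *\<^sub>v v1 \<le> A *\<^sub>v v2"
    and \<Phi>: "minimal_nonneg_solution m n (\<lambda>X. X * C * X - X * D - A * X + B = 0\<^sub>m m n) \<Phi>"
  shows "\<And>z. z \<in># eigenvalue_mset (A - \<Phi> * C) \<Longrightarrow> Re z > 0 \<or> z = 0"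
    and "\<And>z. z \<in># eigenvalue_mset (D - C * \<Phi>) \<Longrightarrow> Re z > 0 \<or> z = 0"
    and "\<exists>x. complex_of_real x \<in># eigenvalue_mset (D - C * \<Phi>) \<and>
      (\<forall>z \<in># eigenvalue_mset (D - C * \<Phi>). x \<le> Re z \<and> (Re z = x \<longrightarrow> z = complex_of_real x))"
proof -
  \<comment> \<open>Any positive \<open>s\<close> above all diagonal entries makes \<open>s I - A\<close> and \<open>s I - D\<close> nonnegative.\<close>
  define s where "s = 1 + (\<Sum>i<n. \<bar>D $$ (i, i)\<bar>) + (\<Sum>i<m. \<bar>A $$ (i, i)\<bar>)"
  have nn: "0 \<le> (\<Sum>i<n. \<bar>D $$ (i, i)\<bar>)" "0 \<le> (\<Sum>i<m. \<bar>A $$ (i, i)\<bar>)"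
    by (simp_all add: sum_nonneg)
  have s: "s > 0" using nn unfolding s_def by linarith
  have diagD: "D $$ (i, i) \<le> s" if "i < n" for i
  proof -
    have "\<bar>D $$ (i, i)\<bar> \<le> (\<Sum>i<n. \<bar>D $$ (i, i)\<bar>)"
      using that by (intro member_le_sum) auto
    thus ?thesis using nn unfolding s_def by linarith
  qed
  have diagA: "A $$ (i, i) \<le> s" if "i < m" for i
  proof -
    have "\<bar>A $$ (i, i)\<bar> \<le> (\<Sum>i<m. \<bar>A $$ (i, i)\<bar>)"
      using that by (intro member_le_sum) auto
    thus ?thesis using nn unfolding s_def by linarith
  qed
  define P where "P = s \<cdot>\<^sub>m 1\<^sub>m m - A"
  define Q where "Q = s \<cdot>\<^sub>m 1\<^sub>m n - D"
  have P: "P \<in> carrier_mat m m" and Q: "Q \<in> carrier_mat n n" using A D by (auto simp: P_def Q_def)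
  have P0: "0\<^sub>m m m \<le> P" using A offA diagA by (auto simp: P_def less_eq_mat_def)
  have Q0: "0\<^sub>m n n \<le> Q" using D offD diagD by (auto simp: Q_def less_eq_mat_def)
  interpret nonneg_riccati m n P B C Q
    using P B C Q P0 B0 C0 Q0 by unfold_locales
  have sub: "subinvariant (n + m) (four_block_mat Q C B P) s (v1 @\<^sub>v v2)"
  proof -
    have "Q *\<^sub>v v1 = s \<cdot>\<^sub>v v1 - D *\<^sub>v v1" "P *\<^sub>v v2 = s \<cdot>\<^sub>v v2 - A *\<^sub>v v2"
      unfolding P_def Q_def using shifted_mult_vec[OF D v1] shifted_mult_vec[OF A v2] by auto
    hence "Q *\<^sub>v v1 + C *\<^sub>v v2 \<le> s \<cdot>\<^sub>v v1" "B *\<^sub>v v1 + P *\<^sub>v v2 \<le> s \<cdot>\<^sub>v v2"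
      using Dv Av A B C D v1 v2 unfolding less_eq_vec_def by (auto simp del: index_mult_mat_vec)
    hence "(Q *\<^sub>v v1 + C *\<^sub>v v2) @\<^sub>v (B *\<^sub>v v1 + P *\<^sub>v v2) \<le> (s \<cdot>\<^sub>v v1) @\<^sub>v (s \<cdot>\<^sub>v v2)"
      using v1 by (subst append_vec_le[OF add_carrier_vec[OF mult_mat_vec_carrier[OF Q v1]
            mult_mat_vec_carrier[OF C v2]]]) auto
    moreover have "s \<cdot>\<^sub>v (v1 @\<^sub>v v2) = (s \<cdot>\<^sub>v v1) @\<^sub>v (s \<cdot>\<^sub>v v2)" by (intro eq_vecI) auto
    ultimately show ?thesis
      unfolding subinvariant_def four_block_mat_mult_vec[OF Q C B P v1 v2] using v1 v2 pos by auto
  qed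
  have fixp: "step s X = X \<longleftrightarrow> X * C * X - X * D - A * X + B = 0\<^sub>m m n" if X: "X \<in> carrier_mat m n" for X
  proof -
    have c: "X * C * X \<in> carrier_mat m n" "X * D \<in> carrier_mat m n" "A * X \<in> carrier_mat m n"
      using X A C D by auto
    have XQ: "X * Q = s \<cdot>\<^sub>m X - X * D"
      unfolding Q_def using mult_minus_distrib_mat[OF X smult_carrier_mat[OF one_carrier_mat] D]
        mult_smult_distrib[OF X one_carrier_mat] right_mult_one_mat[OF X] by simp
    have PX: "P * X = s \<cdot>\<^sub>m X - A * X"
      unfolding P_def using minus_mult_distrib_mat[OF smult_carrier_mat[OF one_carrier_mat] A X]
        mult_smult_assoc_mat[OF one_carrier_mat X] left_mult_one_mat[OF X] by simp
    have ij: "step s X $$ (i, j) = X $$ (i, j) + (X * C * X - X * D - A * X + B) $$ (i, j) / (2 * s)"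
      if "i < m" "j < n" for i j
    proof -
      have "(X * C * X + X * Q + P * X + B) $$ (i, j) =
        2 * s * X $$ (i, j) + (X * C * X - X * D - A * X + B) $$ (i, j)"
        unfolding XQ PX using that X A B C D by (simp del: index_mult_mat(1))
      moreover have "step s X $$ (i, j) = 1 / (2 * s) * (X * C * X + X * Q + P * X + B) $$ (i, j)"
        unfolding step_def by (rule index_smult_mat) (use that sum_carrier[OF X] in auto)
      ultimately show ?thesis using s by (simp add: add_divide_distrib)
    qed
    show ?thesis
    proof
      assume "step s X = X"
      hence "(X * C * X - X * D - A * X + B) $$ (i, j) = 0" if "i < m" "j < n" for i j
        using ij[OF that] s by simp
      thus "X * C * X - X * D - A * X + B = 0\<^sub>m m n" using c B by (intro eq_matI) auto
    next
      assume "X * C * X - X * D - A * X + B = 0\<^sub>m m n"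
      thus "step s X = X" using ij step_carrier[OF X, of s] X by (intro eq_matI) auto
    qed
  qed
  have \<Phi>c: "\<Phi> \<in> carrier_mat m n" and \<Phi>0: "0\<^sub>m m n \<le> \<Phi>" and fix\<Phi>: "step s \<Phi> = \<Phi>"
    and minimal: "\<And>Y. Y \<in> carrier_mat m n \<Longrightarrow> 0\<^sub>m m n \<le> Y \<Longrightarrow> step s Y = Y \<Longrightarrow> \<Phi> \<le> Y"
    using \<Phi> fixp unfolding minimal_nonneg_solution_def nonneg_mat_def by auto
  have right: "subinvariant n (Q + C * \<Phi>) s (vec_first (v1 @\<^sub>v v2) n)"
    by (rule right_closed_loop_subinvariant[OF s sub \<Phi>c \<Phi>0 fix\<Phi>]) (rule minimal)
  have left: "eigen_bound (P + \<Phi> * C) s"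
    by (rule left_closed_loop_eigen_bound[OF s sub \<Phi>c \<Phi>0 fix\<Phi>]) (rule minimal)
  have c: "P + \<Phi> * C \<in> carrier_mat m m" "Q + C * \<Phi> \<in> carrier_mat n n"
    and nonneg: "0\<^sub>m n n \<le> Q + C * \<Phi>"
    using P Q C \<Phi>c Q0 C0 \<Phi>0 by (auto intro!: add_mat_nonneg mult_mat_nonneg)
  have eqA: "A - \<Phi> * C = s \<cdot>\<^sub>m 1\<^sub>m m - (P + \<Phi> * C)" and eqD: "D - C * \<Phi> = s \<cdot>\<^sub>m 1\<^sub>m n - (Q + C * \<Phi>)"
    using A C D \<Phi>c by (auto simp: P_def Q_def intro!: eq_matI)
  show "\<And>z. z \<in># eigenvalue_mset (A - \<Phi> * C) \<Longrightarrow> Re z > 0 \<or> z = 0"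
    unfolding eqA using shifted_eigenvalues[OF c(1) left s] .
  show "\<And>z. z \<in># eigenvalue_mset (D - C * \<Phi>) \<Longrightarrow> Re z > 0 \<or> z = 0"
    unfolding eqD
    using shifted_eigenvalues[OF c(2) subinvariant_eigen_bound[OF right c(2) nonneg] s] .
  show "\<exists>x. complex_of_real x \<in># eigenvalue_mset (D - C * \<Phi>) \<and>
      (\<forall>z \<in># eigenvalue_mset (D - C * \<Phi>). x \<le> Re z \<and> (Re z = x \<longrightarrow> z = complex_of_real x))"
    unfolding eqD using shifted_dominant_eigenvalue[OF right c(2) nonneg n] by metis
qed

section \<open>Splitting of the spectrum\<close>

text \<open>The split of a multiset into its elements of largest real part and the rest is ambiguous when
  real parts coincide at the cut. Here such a coincidence forces both elements to be \<open>0\<close>.\<close>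

lemma multiset_split_by_real_part:
  fixes L1 L2 E1 E2 :: "complex multiset"
  assumes sum: "L1 + L2 = E1 + E2" and size: "size L1 = size E1"
    and sorted: "\<And>x y. x \<in># L1 \<Longrightarrow> y \<in># L2 \<Longrightarrow> Re y \<le> Re x"
    and E1: "\<And>z. z \<in># E1 \<Longrightarrow> Re z > 0 \<or> z = 0" and E2: "\<And>z. z \<in># E2 \<Longrightarrow> Re z < 0 \<or> z = 0"
  shows "L1 = E1" and "L2 = E2"
proof -
  show "L1 = E1"
  proof (rule ccontr)
    assume ne: "L1 \<noteq> E1"
    have "\<not> E1 \<subseteq># L1" "\<not> L1 \<subseteq># E1"
      using ne size by (metis mset_subset_size subset_mset.le_imp_less_or_eq less_irrefl)+
    then obtain x y where x: "count L1 x < count E1 x" and y: "count E1 y < count L1 y"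
      unfolding subseteq_mset_def by (meson not_le)
    have cnt: "count L1 z + count L2 z = count E1 z + count E2 z" for z
      using arg_cong[OF sum, of "\<lambda>M. count M z"] by simp
    have "x \<in># L2" "y \<in># E2" "x \<in># E1" "y \<in># L1"
      using cnt[of x] cnt[of y] x y unfolding count_greater_zero_iff[symmetric] by linarith+
    hence "Re x \<le> Re y" "Re x > 0 \<or> x = 0" "Re y < 0 \<or> y = 0"
      using sorted E1 E2 by blast+
    hence "x = y" by auto
    thus False using x y by simp
  qed
  thus "L2 = E2" using sum by simp
qed

theorem theorem6:
  fixes m n :: nat
    and A B C D \<Phi> \<Psi> :: "real mat"
    and l :: "nat \<Rightarrow> complex"
  assumes "m \<ge> 1" and "n \<ge> 1"
    and "A \<in> carrier_mat m m" and "B \<in> carrier_mat m n"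
    and "C \<in> carrier_mat n m" and "D \<in> carrier_mat n n"
    and "regular_M_matrix (four_block_mat D (- C) (- B) A)"
    and "eigenvalue_mset (four_block_mat D (- C) B (- A)) = {# l i. i \<in># mset_set {1..n+m} #}"
    and "\<And>i j. 1 \<le> i \<Longrightarrow> i \<le> j \<Longrightarrow> j \<le> n + m \<Longrightarrow> Re (l i) \<ge> Re (l j)"
    and "minimal_nonneg_solution m n (\<lambda>X. X * C * X - X * D - A * X + B = 0\<^sub>m m n) \<Phi>"
    and "minimal_nonneg_solution n m (\<lambda>Y. Y * B * Y - Y * A - D * Y + C = 0\<^sub>m n m) \<Psi>"
  shows "eigenvalue_mset (D - C * \<Phi>) = {# l i. i \<in># mset_set {1..n} #} \<and>
         eigenvalue_mset (A - B * \<Psi>) = {# - l i. i \<in># mset_set {n+1..n+m} #} \<and>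
         l n \<in> \<real> \<and> l (n + 1) \<in> \<real>"
proof -
  note m = assms(1) and n = assms(2) and A = assms(3) and B = assms(4) and C = assms(5) and D = assms(6)
  note ordered = assms(9) and \<Phi> = assms(10) and \<Psi> = assms(11)
  let ?K = "four_block_mat D (- C) (- B) A" and ?H = "four_block_mat D (- C) B (- A)"
  have K: "?K \<in> carrier_mat (n + m) (n + m)" using A D by auto
  have Z: "?K $$ (i, j) \<le> 0" if "i < n + m" "j < n + m" "i \<noteq> j" for i j
    using assms(7) that K unfolding regular_M_matrix_def M_matrix_def Z_matrix_def by auto
  obtain v where v: "v \<in> carrier_vec (n + m)" and vpos: "\<And>i. i < n + m \<Longrightarrow> v $ i > 0"
    and Kv: "?K *\<^sub>v v \<ge> 0\<^sub>v (n + m)"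
    using assms(7) K unfolding regular_M_matrix_def by auto
  define v1 where "v1 = vec_first v n"
  define v2 where "v2 = vec_last v m"
  have v1: "v1 \<in> carrier_vec n" and v2: "v2 \<in> carrier_vec m" and vv: "v = v1 @\<^sub>v v2"
    using v by (auto simp: v1_def v2_def)
  have pos: "\<And>i. i < n \<Longrightarrow> v1 $ i > 0" "\<And>i. i < m \<Longrightarrow> v2 $ i > 0"
    using vpos v by (auto simp: v1_def v2_def vec_first_def vec_last_def)
  have offD: "D $$ (i, j) \<le> 0" if "i < n" "j < n" "i \<noteq> j" for i j
    using Z[of i j] that A D by auto
  have offA: "A $$ (i, j) \<le> 0" if "i < m" "j < m" "i \<noteq> j" for i j
    using Z[of "n + i" "n + j"] that A D by auto
  have C0: "0\<^sub>m n m \<le> C"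
  proof -
    have "C $$ (i, j) \<ge> 0" if "i < n" "j < m" for i j
      using Z[of i "n + j"] that A C D by auto
    thus ?thesis using C by (auto simp: less_eq_mat_def)
  qed
  have B0: "0\<^sub>m m n \<le> B"
  proof -
    have "B $$ (i, j) \<ge> 0" if "i < m" "j < n" for i j
      using Z[of "n + i" j] that A B D by auto
    thus ?thesis using B by (auto simp: less_eq_mat_def)
  qed
  have "(D *\<^sub>v v1 + (- C) *\<^sub>v v2) @\<^sub>v ((- B) *\<^sub>v v1 + A *\<^sub>v v2) \<ge> 0\<^sub>v n @\<^sub>v 0\<^sub>v m"
  proof -
    have "0\<^sub>v n @\<^sub>v 0\<^sub>v m = (0\<^sub>v (n + m) :: real vec)" by (intro eq_vecI) auto
    thus ?thesis using Kv four_block_mat_mult_vec[OF D _ _ A v1 v2, of "- C" "- B"] B C vv by auto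
  qed
  hence ge: "D *\<^sub>v v1 + (- C) *\<^sub>v v2 \<ge> 0\<^sub>v n" "(- B) *\<^sub>v v1 + A *\<^sub>v v2 \<ge> 0\<^sub>v m"
    using append_vec_le[of "0\<^sub>v n" n "D *\<^sub>v v1 + (- C) *\<^sub>v v2"]
      add_carrier_vec[OF mult_mat_vec_carrier[OF D v1] mult_mat_vec_carrier[OF _ v2, of "- C"]] C by auto
  have "(- C) *\<^sub>v v2 = - (C *\<^sub>v v2)" "(- B) *\<^sub>v v1 = - (B *\<^sub>v v1)"
    using B C v1 v2 by (auto intro!: eq_vecI)
  with ge have Dv: "C *\<^sub>v v2 \<le> D *\<^sub>v v1" and Av: "B *\<^sub>v v1 \<le> A *\<^sub>v v2"
    using A B C D v1 v2 unfolding less_eq_vec_def by (auto simp del: index_mult_mat_vec)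
  have n0: "n > 0" and m0: "m > 0" using n m by auto
  note primal = closed_loop_spectra[OF n0 A B C D offA offD B0 C0 v1 v2 pos Dv Av \<Phi>]
  \<comment> \<open>The hypotheses are invariant under exchanging \<open>(A, B)\<close> with \<open>(D, C)\<close>.\<close>
  note dual = closed_loop_spectra[OF m0 D C B A offD offA C0 B0 v2 v1 pos(2,1) Av Dv \<Psi>]
  have \<Phi>c: "\<Phi> \<in> carrier_mat m n" and ric: "\<Phi> * C * \<Phi> - \<Phi> * D - A * \<Phi> + B = 0\<^sub>m m n"
    and \<Psi>c: "\<Psi> \<in> carrier_mat n m" and ric': "\<Psi> * B * \<Psi> - \<Psi> * A - D * \<Psi> + C = 0\<^sub>m n m"
    using \<Phi> \<Psi> by (auto simp: minimal_nonneg_solution_def)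
  define L1 where "L1 = {# l i. i \<in># mset_set {1..n} #}"
  define L2 where "L2 = {# l i. i \<in># mset_set {n+1..n+m} #}"
  have H: "eigenvalue_mset ?H = L1 + L2"
  proof -
    have "{1..n+m} = {1..n} \<union> {n+1..n+m}" by auto
    hence "mset_set {1..n+m} = mset_set {1..n} + mset_set {n+1..n+m}"
      by (simp add: mset_set_Union)
    thus ?thesis using assms(8) by (simp add: L1_def L2_def)
  qed
  have sorted: "Re y \<le> Re x" if "x \<in># L1" "y \<in># L2" for x y
    using that ordered by (auto simp: L1_def L2_def)
  have DC: "D - C * \<Phi> \<in> carrier_mat n n" and DB: "D - \<Psi> * B \<in> carrier_mat n n"
    using B C D \<Phi>c \<Psi>c by auto
  have L1: "L1 = eigenvalue_mset (D - C * \<Phi>)"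
  proof (rule multiset_split_by_real_part(1)[OF _ _ sorted primal(2)])
    show "L1 + L2 = eigenvalue_mset (D - C * \<Phi>) + image_mset uminus (eigenvalue_mset (A - \<Phi> * C))"
      using H hamiltonian_eigenvalues[OF A B C D \<Phi>c ric] by simp
    show "size L1 = size (eigenvalue_mset (D - C * \<Phi>))"
      using size_eigenvalue_mset[OF DC] by (simp add: L1_def)
    show "Re z < 0 \<or> z = 0" if "z \<in># image_mset uminus (eigenvalue_mset (A - \<Phi> * C))" for z
      using that primal(1) by force
  qed
  have L2: "L2 = image_mset uminus (eigenvalue_mset (A - B * \<Psi>))"
  proof (rule multiset_split_by_real_part(2)[OF _ _ sorted dual(1)])
    have H': "?H \<in> carrier_mat (n + m) (n + m)" using A D by auto
    have "- ?H = four_block_mat (- D) C (- B) A" using A B C D by (intro eq_matI) auto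
    hence "image_mset uminus (L1 + L2) = eigenvalue_mset (four_block_mat (- D) C (- B) A)"
      using eigenvalue_mset_uminus[OF H'] H by simp
    also have "\<dots> = eigenvalue_mset (four_block_mat A (- B) C (- D))"
      using A B C D by (intro eigenvalue_mset_similar similar_mat_swap_blocks) auto
    also have "\<dots> = eigenvalue_mset (A - B * \<Psi>) + image_mset uminus (eigenvalue_mset (D - \<Psi> * B))"
      by (rule hamiltonian_eigenvalues[OF D C B A \<Psi>c ric'])
    finally have "image_mset uminus (image_mset uminus (L1 + L2)) = image_mset uminus
      (eigenvalue_mset (A - B * \<Psi>) + image_mset uminus (eigenvalue_mset (D - \<Psi> * B)))" by simp
    thus "L1 + L2 = eigenvalue_mset (D - \<Psi> * B) + image_mset uminus (eigenvalue_mset (A - B * \<Psi>))"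
      by (simp add: multiset.map_comp o_def add.commute)
    show "size L1 = size (eigenvalue_mset (D - \<Psi> * B))"
      using size_eigenvalue_mset[OF DB] by (simp add: L1_def)
    show "Re z < 0 \<or> z = 0" if "z \<in># image_mset uminus (eigenvalue_mset (A - B * \<Psi>))" for z
      using that dual(2) by force
  qed
  have L2': "eigenvalue_mset (A - B * \<Psi>) = {# - l i. i \<in># mset_set {n+1..n+m} #}"
  proof -
    have "eigenvalue_mset (A - B * \<Psi>) = image_mset uminus L2"
      unfolding L2 by (simp add: multiset.map_comp o_def)
    thus ?thesis by (simp add: L2_def multiset.map_comp o_def)
  qed
  obtain x where x: "complex_of_real x \<in># L1"
    and x_min: "\<forall>z \<in># L1. x \<le> Re z \<and> (Re z = x \<longrightarrow> z = complex_of_real x)"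
    using primal(3) unfolding L1 by blast
  obtain i where i: "1 \<le> i" "i \<le> n" "complex_of_real x = l i" using x by (auto simp: L1_def)
  have "l n \<in># L1" using n by (auto simp: L1_def)
  hence "l n = complex_of_real x"
    using x_min ordered[of i n] i m by (metis Re_complex_of_real order_antisym le_add1)
  hence real1: "l n \<in> \<real>" by simp
  obtain y where y: "complex_of_real y \<in># eigenvalue_mset (A - B * \<Psi>)"
    and y_min: "\<forall>z \<in># eigenvalue_mset (A - B * \<Psi>). y \<le> Re z \<and> (Re z = y \<longrightarrow> z = complex_of_real y)"
    using dual(3) by blast
  obtain j where j: "n + 1 \<le> j" "j \<le> n + m" "complex_of_real y = - l j" using y by (auto simp: L2')
  have "- l (n + 1) \<in># eigenvalue_mset (A - B * \<Psi>)" using m by (auto simp: L2')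
  moreover have "Re (- l (n + 1)) \<le> y"
  proof -
    have "y = - Re (l j)" using arg_cong[OF j(3), of Re] by simp
    thus ?thesis using ordered[of "n + 1" j] j(1,2) by simp
  qed
  ultimately have "- l (n + 1) = complex_of_real y" using y_min by (metis order_antisym)
  hence "l (n + 1) = complex_of_real (- y)" by (simp add: minus_equation_iff)
  hence real2: "l (n + 1) \<in> \<real>" by (metis Reals_of_real)
  show ?thesis using L1 L2' real1 real2 unfolding L1_def by simp
qed

end
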